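(* Let $3\le p<p'$ be relatively prime integers with $1<t<2$, where $t=p'/p$. Let $1\le r\le p-1$, $1\le a\le p'-1$, $m\ge0$, and let $b$ be the unique integer with $1\le b\le p'-1$, $b\equiv a\bmod 2$ and $\Delta_{r,b}=\min\{\Delta_{r,s}: 1\le s\le p'-1,\ s\equiv a\bmod2\}$. Then $$I^{(p,p')}_{r,a,b,m}(q)=\sum_{\mathbf s\in\mathcal P^{(p')}_{a,b,m}}q^{E(\mathbf s)+m(\Delta_{r,s_{m-1}}-\Delta_{r,b}+\delta_{s_{m-1},b})+\Delta_{r,b}-\Delta_{r,a}}.$$
   Context: $\Delta_{r,s}=\frac{(rt-s)^2-(t-1)^2}{4t}$. Notation: $(x)_n=\prod_{i=0}^{n-1}(1-q^ix)$, $(q)_a=\prod_{i=1}^a(1-q^i)$; $\left[{L\atop a}\right]_q=\frac{(q^{L-a+1})_a}{(q)_a}$ for $a\in\mathbb Z_{\ge0}$, $L\in\mathbb Z$, and $0$ otherwise. For $m\ge0$, $l\in\mathbb Z$, $$S_{m,l}(q)=\sum_{\nu\in\mathbb Z}q^{(\nu+l-m)(\nu+l)+\nu(\nu-m)}\left[{m\atop\nu}\right]_q\left[{\nu\atop m-l-\nu}\right]_q ,$$ and $$I^{(p,p')}_{r,a,b,m}(q)=\sum_{\lambda\in\mathbb Z}q^{\lambda^2pp'+\lambda(p'r-pa)+m^2-((a-b)/2-p'\lambda)^2}S_{m,(a-b)/2-p'\lambda}(q)-\sum_{\lambda\in\mathbb Z}q^{\lambda^2pp'+\lambda(p'r+pa)+ra+m^2-((a+b)/2+p'\lambda)^2}S_{m,(a+b)/2+p'\lambda}(q).$$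 Paths: $\mathcal P^{(p')}_{a,b,m}$ is the set of integer sequences $\mathbf s=(s_0,\dots,s_m)$ with $s_0=a$, $s_m=b$, $1\le s_i\le p'-1$, $s_i-s_{i+1}\in\{0,2,-2\}$ and $(s_i,s_{i+1})\ne(1,1),(p'-1,p'-1)$. Put $E(\mathbf s)=\sum_{i=1}^{m-1}i\,w(s_{i-1},s_i,s_{i+1})$. For $m=0$ the term $m(\cdots)$ in the exponent is $0$. Weights: $[x]$ is the integer part, $\{x\}=x-[x]$. For $1\le s\le p'-1$ let $\tau(s)=\left[\frac{s+1}{t}\right]-\left[\frac{s-1}{t}\right]\in\{1,2\}$. Then - $w(s\pm2,s,s\mp2)=\frac2t$; - $w(s,s+2,s+2)=w(s+2,s+2,s)=2-\left\{\frac{s+1}t\right\}$; - $w(s,s,s+2)=w(s+2,s,s)=1+\left\{\frac{s+1}t\right\}$; - $w(s,s+2,s)=-2\left\{\frac{s+1}t\right\}+x(s)$; - $w(s,s,s)=3-\tau(s)$; - $w(s,s-2,s)=2\left\{\frac{s+1}t\right\}-\frac4t+y(s)$. Here $(x(s),y(s))=(2,4)$ if $\tau(s)=2$; each $s$ with $\tau(s)=1$ is given type $1_A$, with $(x(s),y(s))=(2,3)$, or type $1_B$, with $(x(s),y(s))=(3,2)$, by the rule: - If $1<t\le 5/3$: $s$ with $\tau(s)=1$ has type $1_A$ if $s<p'/2$ and $1_B$ if $s>p'/2$, except that when $3/2<t\le5/3$ the value $s=2$ has type $1_B$ and $s=p'-2$ has type $1_A$. (If $p'$ is even then $\tau(p'/2)=2$.)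 - If $5/3<t<2$: the sequence $\tau(1),\tau(2),\dots,\tau(p'-1)$ is $1_A,1_B,1_A,1_B,\dots,1_B,1_A,2,1_B,1_A,\dots,1_B,1_A,2,\dots,2,1_B,1_A,\dots,1_B,1_A,2$; that is, before the first $2$ the types alternate starting with $1_A$, and after each $2$ the types alternate starting with $1_B$ until the next $2$. *)

theory Defs
  imports
    "HOL.Rat"
    "HOL-Library.Poly_Mapping"
    "HOL-Library.Groups_Big_Fun"
    "HOL-Computational_Algebra.Fraction_Field"
begin

section \<open>Rational powers of a formal variable\<close>

text \<open>
  The exponents on the path side are a priori only rational numbers, and the \<open>q\<close>-binomials are
  quotients.  We therefore work in the field of fractions of the group ring of the additive group
  of rationals with integer coefficients, i.e. of the domain of finite sums of \<open>c q\<^sup>e\<close>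
  with \<open>c\<close> an integer and \<open>e\<close> rational.
\<close>

type_synonym qfield = "(rat \<Rightarrow>\<^sub>0 int) fract"

definition qpow :: "rat \<Rightarrow> qfield" where
  "qpow e = Fract (Poly_Mapping.single e 1) 1"

lemma qpow_0: "qpow 0 = 1"
  by (simp add: qpow_def One_fract_def)

lemma qpow_add: "qpow (d + e) = qpow d * qpow e"
  by (simp add: qpow_def mult_single)

lemma qpow_eq_iff: "qpow d = qpow e \<longleftrightarrow> d = e"
proof
  assume "qpow d = qpow e"
  then have "Poly_Mapping.single d (1::int) = Poly_Mapping.single e 1"
    by (simp add: qpow_def eq_fract)
  then have "Poly_Mapping.lookup (Poly_Mapping.single d (1::int)) d =
      Poly_Mapping.lookup (Poly_Mapping.single e 1) d"
    by simp
  then show "d = e"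
    by (metis lookup_single_eq lookup_single_not_eq zero_neq_one)
qed simp

definition qpoch :: "qfield \<Rightarrow> nat \<Rightarrow> qfield" where
  "qpoch x n = (\<Prod>i<n. 1 - qpow (of_nat i) * x)"

definition qfact :: "nat \<Rightarrow> qfield" where
  "qfact a = (\<Prod>i=1..a. 1 - qpow (of_nat i))"

lemma qfact_nonzero: "qfact a \<noteq> 0"
proof -
  have "1 - qpow (of_nat i) \<noteq> 0" if "i \<ge> 1" for i
    using that qpow_eq_iff[of 0 "of_nat i"] by (auto simp: qpow_0)
  then show ?thesis
    by (auto simp: qfact_def)
qed

definition qbinom :: "int \<Rightarrow> int \<Rightarrow> qfield" where
  "qbinom L a =
     (if 0 \<le> a then qpoch (qpow (of_int (L - a + 1))) (nat a) / qfact (nat a) else 0)"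

lemma qbinom_eq_0:
  assumes "0 \<le> L" and "L < a"
  shows "qbinom L a = 0"
proof -
  define j where "j = nat (a - L - 1)"
  have j: "j < nat a" "int j = a - L - 1"
    using assms by (auto simp: j_def)
  have "(of_nat j :: rat) + of_int (L - a + 1) = of_int (int j + (L - a + 1))"
    by simp
  also have "\<dots> = 0"
    using j by simp
  finally have "qpow (of_nat j) * qpow (of_int (L - a + 1)) = 1"
    by (simp only: qpow_add[symmetric] qpow_0)
  then have "qpoch (qpow (of_int (L - a + 1))) (nat a) = 0"
    unfolding qpoch_def using j(1) by (intro prod_zero) auto
  then show ?thesis
    by (simp add: qbinom_def)
qed

section \<open>The alternating sum\<close>

text \<open>
  Sums over all integers are written with \<^const>\<open>Sum_any\<close>, the sum over the support, which
  is \<open>0\<close> by convention if the support is infinite.  The finiteness lemmas below show that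
  this convention is never used, provided \<open>p' \<noteq> 0\<close>.
\<close>

definition S_sum :: "nat \<Rightarrow> int \<Rightarrow> qfield" where
  "S_sum m l =
     (\<Sum>\<nu>. qpow (of_int ((\<nu> + l - int m) * (\<nu> + l) + \<nu> * (\<nu> - int m)))
          * qbinom (int m) \<nu> * qbinom \<nu> (int m - l - \<nu>))"

lemma qbinom_product_support:
  assumes "qbinom (int m) \<nu> * qbinom \<nu> (int m - l - \<nu>) \<noteq> 0"
  shows "0 \<le> \<nu>" and "\<nu> \<le> int m" and "\<bar>l\<bar> \<le> int m"
proof -
  show 1: "0 \<le> \<nu>"
    using assms by (auto simp: qbinom_def split: if_splits)
  show 2: "\<nu> \<le> int m"
    using assms qbinom_eq_0[of "int m" \<nu>] by fastforce
  have "0 \<le> int m - l - \<nu>"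
    using assms by (auto simp: qbinom_def split: if_splits)
  moreover have "int m - l - \<nu> \<le> \<nu>"
    using assms 1 qbinom_eq_0[of \<nu> "int m - l - \<nu>"] by fastforce
  ultimately show "\<bar>l\<bar> \<le> int m"
    using 1 2 by linarith
qed

lemma finite_support_S_sum:
  "finite {\<nu>. qpow (of_int ((\<nu> + l - int m) * (\<nu> + l) + \<nu> * (\<nu> - int m)))
          * qbinom (int m) \<nu> * qbinom \<nu> (int m - l - \<nu>) \<noteq> 0}"
proof (rule finite_subset)
  show "{\<nu>. qpow (of_int ((\<nu> + l - int m) * (\<nu> + l) + \<nu> * (\<nu> - int m)))
          * qbinom (int m) \<nu> * qbinom \<nu> (int m - l - \<nu>) \<noteq> 0} \<subseteq> {0..int m}"
    using qbinom_product_support[of m _ l] by force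
qed simp

lemma S_sum_eq_0:
  assumes "int m < \<bar>l\<bar>"
  shows "S_sum m l = 0"
proof -
  have "qbinom (int m) \<nu> * qbinom \<nu> (int m - l - \<nu>) = 0" for \<nu>
    using qbinom_product_support(3)[of m \<nu> l] assms by force
  then show ?thesis
    by (simp only: S_sum_def mult.assoc mult_zero_right Sum_any.neutral)
qed

lemma finite_support_S_sum_shift:
  assumes "p' \<noteq> 0"
  shows "finite {n. c n * S_sum m (k + p' * n) \<noteq> 0}"
proof (rule finite_subset)
  show "{n. c n * S_sum m (k + p' * n) \<noteq> 0} \<subseteq> {- (int m + \<bar>k\<bar>)..int m + \<bar>k\<bar>}"
  proof
    fix n assume "n \<in> {n. c n * S_sum m (k + p' * n) \<noteq> 0}"
    then have *: "\<bar>k + p' * n\<bar> \<le> int m"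
      using S_sum_eq_0[of m "k + p' * n"] by force
    have "\<bar>n\<bar> \<le> \<bar>p'\<bar> * \<bar>n\<bar>"
      using assms mult_right_mono[of 1 "\<bar>p'\<bar>" "\<bar>n\<bar>"] by simp
    also have "\<dots> = \<bar>p' * n\<bar>"
      by (simp add: abs_mult)
    finally show "n \<in> {- (int m + \<bar>k\<bar>)..int m + \<bar>k\<bar>}"
      using * by auto
  qed
qed simp

text \<open>
  Only used for \<open>a\<close> and \<open>b\<close> of equal parity, so that the divisions by \<open>2\<close> are exact.
\<close>

definition I_sum :: "int \<Rightarrow> int \<Rightarrow> int \<Rightarrow> int \<Rightarrow> int \<Rightarrow> nat \<Rightarrow> qfield" where
  "I_sum p p' r a b m =
     (\<Sum>n. qpow (of_int (n^2 * p * p' + n * (p' * r - p * a) + (int m)^2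
                      - ((a - b) div 2 - p' * n)^2))
          * S_sum m ((a - b) div 2 - p' * n))
   - (\<Sum>n. qpow (of_int (n^2 * p * p' + n * (p' * r + p * a) + r * a + (int m)^2
                      - ((a + b) div 2 + p' * n)^2))
          * S_sum m ((a + b) div 2 + p' * n))"

section \<open>Weighted paths\<close>

definition Delta :: "rat \<Rightarrow> int \<Rightarrow> int \<Rightarrow> rat" where
  "Delta t r s = ((of_int r * t - of_int s)^2 - (t - 1)^2) / (4 * t)"

definition tau :: "rat \<Rightarrow> int \<Rightarrow> int" where
  "tau t s = \<lfloor>of_int (s + 1) / t\<rfloor> - \<lfloor>of_int (s - 1) / t\<rfloor>"

datatype site_type = Two | OneA | OneB

text \<open>
  The rule for \<open>5/3 < t < 2\<close>.  The value at \<open>0\<close> is a fictitious one, chosen so that the first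
  site gets type \<open>1\<^sub>A\<close>.
\<close>

fun alternating_type :: "rat \<Rightarrow> nat \<Rightarrow> site_type" where
  "alternating_type t 0 = OneB"
| "alternating_type t (Suc n) =
     (if tau t (int (Suc n)) = 2 then Two
      else (case alternating_type t n of
              Two \<Rightarrow> OneB
            | OneA \<Rightarrow> OneB
            | OneB \<Rightarrow> OneA))"

definition type_of_site :: "rat \<Rightarrow> int \<Rightarrow> int \<Rightarrow> site_type" where
  "type_of_site t p' s =
     (if tau t s = 2 then Two
      else if t \<le> 5 / 3 then
        (if 3 / 2 < t \<and> s = 2 then OneB
         else if 3 / 2 < t \<and> s = p' - 2 then OneA
         else if 2 * s < p' then OneA
         else OneB)
      else alternating_type t (nat s))"

definition xval :: "rat \<Rightarrow> int \<Rightarrow> int \<Rightarrow> rat" where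
  "xval t p' s = (case type_of_site t p' s of Two \<Rightarrow> 2 | OneA \<Rightarrow> 2 | OneB \<Rightarrow> 3)"

definition yval :: "rat \<Rightarrow> int \<Rightarrow> int \<Rightarrow> rat" where
  "yval t p' s = (case type_of_site t p' s of Two \<Rightarrow> 4 | OneA \<Rightarrow> 3 | OneB \<Rightarrow> 2)"

text \<open>
  The branches are mutually exclusive, and exhaust the triples of consecutive entries of a path;
  the final \<open>0\<close> is never used.
\<close>

definition weight :: "rat \<Rightarrow> int \<Rightarrow> int \<Rightarrow> int \<Rightarrow> int \<Rightarrow> rat" where
  "weight t p' u v z =
     (if (u = v + 2 \<and> z = v - 2) \<or> (u = v - 2 \<and> z = v + 2) then 2 / t
      else if v = u + 2 \<and> z = u + 2 then 2 - frac (of_int (u + 1) / t)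
      else if u = z + 2 \<and> v = z + 2 then 2 - frac (of_int (z + 1) / t)
      else if v = u \<and> z = u + 2 then 1 + frac (of_int (u + 1) / t)
      else if u = v + 2 \<and> z = v then 1 + frac (of_int (v + 1) / t)
      else if v = u + 2 \<and> z = u then - 2 * frac (of_int (u + 1) / t) + xval t p' u
      else if v = u \<and> z = u then 3 - of_int (tau t u)
      else if v = u - 2 \<and> z = u then 2 * frac (of_int (u + 1) / t) - 4 / t + yval t p' u
      else 0)"

lemma weight_simps:
  "weight t p' (s + 2) s (s - 2) = 2 / t"
  "weight t p' (s - 2) s (s + 2) = 2 / t"
  "weight t p' s (s + 2) (s + 2) = 2 - frac (of_int (s + 1) / t)"
  "weight t p' (s + 2) (s + 2) s = 2 - frac (of_int (s + 1) / t)"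
  "weight t p' s s (s + 2) = 1 + frac (of_int (s + 1) / t)"
  "weight t p' (s + 2) s s = 1 + frac (of_int (s + 1) / t)"
  "weight t p' s (s + 2) s = - 2 * frac (of_int (s + 1) / t) + xval t p' s"
  "weight t p' s s s = 3 - of_int (tau t s)"
  "weight t p' s (s - 2) s = 2 * frac (of_int (s + 1) / t) - 4 / t + yval t p' s"
  by (simp_all add: weight_def)

definition paths :: "int \<Rightarrow> int \<Rightarrow> int \<Rightarrow> nat \<Rightarrow> int list set" where
  "paths p' a b m =
     {s. length s = m + 1 \<and> s ! 0 = a \<and> s ! m = b
       \<and> (\<forall>i\<le>m. 1 \<le> s ! i \<and> s ! i \<le> p' - 1)
       \<and> (\<forall>i<m. s ! i - s ! (i + 1) \<in> {0, 2, -2}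
                \<and> (s ! i, s ! (i + 1)) \<noteq> (1, 1)
                \<and> (s ! i, s ! (i + 1)) \<noteq> (p' - 1, p' - 1))}"

lemma finite_paths: "finite (paths p' a b m)"
proof (rule finite_subset)
  show "paths p' a b m \<subseteq> {s. set s \<subseteq> {1..p' - 1} \<and> length s = m + 1}"
    by (auto simp: paths_def in_set_conv_nth less_Suc_eq_le)
  show "finite {s. set s \<subseteq> {1..p' - 1} \<and> length s = m + 1}"
    by (rule finite_lists_length_eq) simp
qed

lemma minimal_label_unique:
  fixes p p' r a :: int
  assumes "3 \<le> p" and "p < p'" and "coprime p p'" and t: "t = of_int p' / of_int p"
    and r: "1 \<le> r" "r \<le> p - 1"
  shows "\<exists>!b. 1 \<le> b \<and> b \<le> p' - 1 \<and> b mod 2 = a mod 2 \<and>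
    Delta t r b = Min {Delta t r s | s. 1 \<le> s \<and> s \<le> p' - 1 \<and> s mod 2 = a mod 2}"
proof -
  let ?A = "{s. 1 \<le> s \<and> s \<le> p' - 1 \<and> s mod 2 = a mod 2}"
  have eq: "{Delta t r s | s. 1 \<le> s \<and> s \<le> p' - 1 \<and> s mod 2 = a mod 2} = Delta t r ` ?A"
    by auto
  have fin: "finite ?A"
    by (rule finite_subset[of _ "{1..p' - 1}"]) auto
  have "1 + (a - 1) mod 2 \<in> ?A"
    using assms(1,2) pos_mod_bound[of 2 "a - 1"] by (auto simp: mod_simps)
  then have "Delta t r ` ?A \<noteq> {}"
    by blast
  with fin have min: "Min (Delta t r ` ?A) \<in> Delta t r ` ?A"
    by (intro Min_in) auto
  have unique: "b = c" if b: "b \<in> ?A" "c \<in> ?A" "Delta t r b = Delta t r c" for b c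
  proof (rule ccontr)
    assume "b \<noteq> c"
    have "t > 0"
      using assms(1,2) t by simp
    with b(3) have "(of_int r * t - of_int b)^2 = (of_int r * t - of_int c)^2"
      by (simp add: Delta_def)
    with \<open>b \<noteq> c\<close> have "of_int r * t - of_int b = - (of_int r * t - of_int c)"
      by (auto simp: power2_eq_iff)
    then have "2 * (of_int r * t) = of_int (b + c)"
      by (simp add: algebra_simps)
    then have "2 * (of_int (r * p') :: rat) = of_int (b + c) * of_int p"
      using assms(1) t by (simp add: field_simps)
    then have "(of_int (2 * (r * p')) :: rat) = of_int ((b + c) * p)"
      by simp
    then have *: "2 * (r * p') = (b + c) * p"
      by (simp only: of_int_eq_iff)
    have "b mod 2 = c mod 2"
      using b(1,2) by simp
    then have "even (b + c)"
      by presburger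
    then obtain k where "b + c = 2 * k"
      by blast
    with * have "r * p' = k * p"
      by simp
    then have "p dvd r * p'"
      by simp
    then have "p dvd r"
      using assms(3) by (simp add: coprime_dvd_mult_left_iff)
    then show False
      using r zdvd_imp_le[of p r] by simp
  qed
  have "\<exists>!b. b \<in> ?A \<and> Delta t r b = Min (Delta t r ` ?A)"
  proof (intro ex_ex1I)
    from min obtain b where "b \<in> ?A" and "Min (Delta t r ` ?A) = Delta t r b"
      by (rule imageE)
    then show "\<exists>b. b \<in> ?A \<and> Delta t r b = Min (Delta t r ` ?A)"
      by (intro exI[of _ b] conjI) simp_all
  next
    fix b c
    assume b: "b \<in> ?A \<and> Delta t r b = Min (Delta t r ` ?A)"
      and c: "c \<in> ?A \<and> Delta t r c = Min (Delta t r ` ?A)"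
    show "b = c"
      by (rule unique[OF b[THEN conjunct1] c[THEN conjunct1]])
        (rule trans[OF b[THEN conjunct2] c[THEN conjunct2, symmetric]])
  qed
  then show ?thesis
    unfolding eq by (simp only: mem_Collect_eq conj_assoc)
qed

definition energy :: "rat \<Rightarrow> int \<Rightarrow> nat \<Rightarrow> int list \<Rightarrow> rat" where
  "energy t p' m s =
     (\<Sum>i\<in>{1..<m}. of_nat i * weight t p' (s ! (i - 1)) (s ! i) (s ! (i + 1)))"

end

(*
  Split a path according to its last step. After removing the second difference of s^2/(4t), every
  weight is an integer determined by N(s) = [(s+1)/t] and the type of a site, and the generating
  function of paths ending in a given edge b -> c is a path sum ending in b in which the last step
  carries a weight (-alpha, 1, beta) for a step down, level or up. The same recursion is satisfied by
  the sums Phi(alpha, beta; l) of q^(mn + 2ik - alpha i + beta k) times the q-multinomial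
  coefficient of (i, k, n), with i + k + n = m and i - k = l: termwise at sites of type 1A and 1B,
  and up to a telescoping sum at sites with tau = 2. Only beta - alpha in {0, 1} occurs, because a
  site of type 1B is never followed two steps up by one of type 1A. The alternating sum of Phi over
  reflections and translations satisfies the boundary conditions: it vanishes at 0 and p', and at
  the sites 1 and p'-1 the term of the missing level step cancels that of the missing outer step.
  Minimality of Delta(r, b) says exactly that r lies between N(b-2) + 1 and N(b), for which
  alpha = beta = r is a pair of weights to which the recursion applies.
*)

theory Submission
  imports Defs
begin

section \<open>\<open>q\<close>-trinomials and their recursions\<close>

abbreviation qz :: "int \<Rightarrow> qfield" where
  "qz e \<equiv> qpow (of_int e)"

lemma qz_add: "qz (d + e) = qz d * qz e"
  by (simp add: qpow_add)

lemma qz_eq_1_iff: "qz e = 1 \<longleftrightarrow> e = 0"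
  using qpow_eq_iff[of "of_int e" 0] by (simp add: qpow_0)

lemma qfact_Suc: "qfact (Suc n) = (1 - qz (int (Suc n))) * qfact n"
  by (simp add: qfact_def)

text \<open>The value 0 outside the nonnegative range lets the three ratio identities that follow
  hold for all integers, so index shifts need no case distinctions.\<close>

definition qmultinom :: "int \<Rightarrow> int \<Rightarrow> int \<Rightarrow> qfield" where
  "qmultinom i k n =
     (if 0 \<le> i \<and> 0 \<le> k \<and> 0 \<le> n
      then qfact (nat (i + k + n)) / (qfact (nat i) * qfact (nat k) * qfact (nat n)) else 0)"

lemma qmultinom_commute: "qmultinom i k n = qmultinom k i n"
  by (simp add: qmultinom_def add.commute mult.commute)

lemma qmultinom_commute': "qmultinom i k n = qmultinom n k i"
  by (simp add: qmultinom_def ac_simps)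

lemma qmultinom_pred_left:
  "(1 - qz (i + k + n)) * qmultinom (i - 1) k n = (1 - qz i) * qmultinom i k n"
proof (cases "1 \<le> i \<and> 0 \<le> k \<and> 0 \<le> n")
  case True
  define j where "j = nat (i - 1)"
  define l where "l = nat (i - 1 + k + n)"
  have j: "nat (i - 1) = j" "nat i = Suc j" "int (Suc j) = i"
    and l: "nat (i - 1 + k + n) = l" "nat (i + k + n) = Suc l" "int (Suc l) = i + k + n"
    using True by (auto simp: j_def l_def)
  have "1 - qz i \<noteq> 0"
    using qz_eq_1_iff[of i] True by auto
  then show ?thesis
    using True by (simp add: qmultinom_def j l qfact_Suc qfact_nonzero del: of_nat_Suc)
next
  case False
  then show ?thesis
    by (cases "i = 0") (auto simp: qmultinom_def qpow_0)
qed

lemma qmultinom_pred_mid: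
  "(1 - qz (i + k + n)) * qmultinom i (k - 1) n = (1 - qz k) * qmultinom i k n"
  using qmultinom_pred_left[of k i n] by (simp add: qmultinom_commute[of i] add.commute)

lemma qmultinom_pred_right:
  "(1 - qz (i + k + n)) * qmultinom i k (n - 1) = (1 - qz n) * qmultinom i k n"
  using qmultinom_pred_left[of n k i] by (simp add: qmultinom_commute'[of i] ac_simps)

text \<open>Multiplying by \<open>1 - qz (i + k + n)\<close> turns each coefficient with one
  argument lowered into a multiple of \<open>qmultinom i k n\<close>, so every Pascal-type rule
  reduces to an identity of powers of q.\<close>

lemma qmultinom_pascal:
  assumes "i + k + n \<noteq> 0"
    and "qz e1 * (1 - qz i) + qz e2 * (1 - qz n) + qz e3 * (1 - qz k) = qz e0 * (1 - qz (i + k + n))"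
  shows "qz e0 * qmultinom i k n =
    qz e1 * qmultinom (i - 1) k n + qz e2 * qmultinom i k (n - 1) + qz e3 * qmultinom i (k - 1) n"
proof -
  let ?Q = "1 - qz (i + k + n)"
  have "?Q * (qz e1 * qmultinom (i - 1) k n + qz e2 * qmultinom i k (n - 1) + qz e3 * qmultinom i (k - 1) n)
    = qz e1 * (?Q * qmultinom (i - 1) k n) + qz e2 * (?Q * qmultinom i k (n - 1))
      + qz e3 * (?Q * qmultinom i (k - 1) n)"
    by (simp add: algebra_simps)
  also have "\<dots> = (qz e1 * (1 - qz i) + qz e2 * (1 - qz n) + qz e3 * (1 - qz k)) * qmultinom i k n"
    unfolding qmultinom_pred_left qmultinom_pred_mid qmultinom_pred_right by (simp add: algebra_simps)
  also have "\<dots> = ?Q * (qz e0 * qmultinom i k n)"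
    unfolding assms(2) by (simp add: algebra_simps)
  finally show ?thesis
    using assms(1) qz_eq_1_iff[of "i + k + n"] by (metis eq_iff_diff_eq_0 mult_cancel_left)
qed

section \<open>Weighted q-trinomials and their recursions\<close>

definition tri_term :: "int \<Rightarrow> int \<Rightarrow> int \<Rightarrow> int \<Rightarrow> int \<Rightarrow> qfield" where
  "tri_term m \<alpha> \<beta> i k =
     qz (m * (m - i - k) + 2 * i * k - \<alpha> * i + \<beta> * k) * qmultinom i k (m - i - k)"

text \<open>
  The parameters record the weights of the last step of a path: a final step down, level or up at
  time \<open>m\<close> contributes \<open>q\<close> to the power \<open>-\<alpha>m\<close>, \<open>m\<close> or \<open>\<beta>m\<close>.
  For \<open>\<alpha> = \<beta> = 0\<close> the sum is the \<open>q\<close>-trinomial \<open>S\<^bsub>m,l\<^esub>\<close> up to a power of \<open>q\<close>;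
  the recursions also involve \<open>\<beta> = \<alpha> + 1\<close>, a second kind of \<open>q\<close>-trinomial.
\<close>

definition trinom :: "int \<Rightarrow> int \<Rightarrow> int \<Rightarrow> int \<Rightarrow> qfield" where
  "trinom m \<alpha> \<beta> l = (\<Sum>k\<in>{0..m}. tri_term m \<alpha> \<beta> (k + l) k)"

lemma tri_term_eq_0: "i < 0 \<or> k < 0 \<or> m < i + k \<Longrightarrow> tri_term m \<alpha> \<beta> i k = 0"
  by (auto simp: tri_term_def qmultinom_def)

lemma trinom_superset:
  assumes "finite A" and "{0..m} \<subseteq> A"
  shows "trinom m \<alpha> \<beta> l = (\<Sum>k\<in>A. tri_term m \<alpha> \<beta> (k + l) k)"
  unfolding trinom_def using assms
  by (intro sum.mono_neutral_left) (auto intro!: tri_term_eq_0)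

lemma trinom_eq_0: "m < \<bar>l\<bar> \<Longrightarrow> trinom m \<alpha> \<beta> l = 0"
  unfolding trinom_def by (intro sum.neutral ballI tri_term_eq_0) auto

lemma trinom_0: "trinom 0 \<alpha> \<beta> l = (if l = 0 then 1 else 0)"
  by (auto simp: trinom_eq_0)
    (simp add: trinom_def tri_term_def qmultinom_def qfact_def qpow_0)

text \<open>Exchanging \<open>i\<close> and \<open>k\<close> negates \<open>l\<close> and turns the
  weights (\<alpha>, \<beta>) into (-\<beta>, -\<alpha>).\<close>

lemma trinom_reflect: "trinom m (- \<beta>) (- \<alpha>) (- l) = trinom m \<alpha> \<beta> l"
proof -
  let ?A = "{- \<bar>m\<bar> - \<bar>l\<bar>..\<bar>m\<bar> + \<bar>l\<bar>}"
  let ?B = "{- \<bar>m\<bar> - \<bar>l\<bar> - l..\<bar>m\<bar> + \<bar>l\<bar> - l}"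
  have "trinom m (- \<beta>) (- \<alpha>) (- l) = (\<Sum>k\<in>?A. tri_term m (- \<beta>) (- \<alpha>) (k - l) k)"
    by (subst trinom_superset[of ?A]) auto
  also have "\<dots> = (\<Sum>k\<in>?B. tri_term m (- \<beta>) (- \<alpha>) k (k + l))"
    by (rule sum.reindex_bij_witness[of _ "\<lambda>k. k + l" "\<lambda>k. k - l"]) auto
  also have "\<dots> = (\<Sum>k\<in>?B. tri_term m \<alpha> \<beta> (k + l) k)"
    unfolding tri_term_def
    by (intro sum.cong refl arg_cong2[of _ _ _ _ "(*)"] arg_cong[of _ _ qz])
      (simp_all add: algebra_simps qmultinom_commute)
  also have "\<dots> = (\<Sum>k\<in>{0..m} \<union> ?B. tri_term m \<alpha> \<beta> (k + l) k)"
    by (intro sum.mono_neutral_left) (auto intro!: tri_term_eq_0)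
  also have "\<dots> = trinom m \<alpha> \<beta> l"
    by (subst trinom_superset[of "{0..m} \<union> ?B"]) auto
  finally show ?thesis .
qed

text \<open>This and the next two lemmas put the neighbours of \<open>l\<close> on the common range
  \<open>0..m + 1\<close>; with \<open>i = k + l\<close> their terms sit at (\<open>i\<close>,
  \<open>k - 1\<close>), (\<open>i\<close>, \<open>k\<close>) and (\<open>i - 1\<close>,
  \<open>k\<close>), ready for a comparison term by term.\<close>

lemma trinom_lower: "trinom m \<alpha> \<beta> (l + 1) = (\<Sum>k\<in>{0..m + 1}. tri_term m \<alpha> \<beta> (k + l) (k - 1))"
proof -
  have "trinom m \<alpha> \<beta> (l + 1) = (\<Sum>k\<in>{-1..m}. tri_term m \<alpha> \<beta> (k + (l + 1)) k)"
    by (rule trinom_superset) auto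
  also have "\<dots> = (\<Sum>k\<in>{0..m + 1}. tri_term m \<alpha> \<beta> (k + l) (k - 1))"
    by (rule sum.reindex_bij_witness[of _ "\<lambda>k. k - 1" "\<lambda>k. k + 1"]) (auto simp: algebra_simps)
  finally show ?thesis .
qed

lemma trinom_same: "trinom m \<alpha> \<beta> l = (\<Sum>k\<in>{0..m + 1}. tri_term m \<alpha> \<beta> (k + l) k)"
  by (rule trinom_superset) auto

lemma trinom_upper: "trinom m \<alpha> \<beta> (l - 1) = (\<Sum>k\<in>{0..m + 1}. tri_term m \<alpha> \<beta> (k + l - 1) k)"
  by (subst trinom_superset[of "{0..m + 1}"]) (auto simp: algebra_simps)

text \<open>The second hypothesis is the exponent condition of \<open>qmultinom_pascal\<close> after
  the common power \<open>qz E\<close> has been divided out; \<open>i\<close>, \<open>k\<close> and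
  \<open>n\<close> count the steps down, up and level.\<close>

lemma trinom_step:
  assumes "0 \<le> m"
    and "\<And>i k n. i - k = l \<Longrightarrow> i + k + n = m + 1 \<Longrightarrow>
      qz (c1 - n - 2 * k - \<alpha>1 * (i - 1) + \<beta>1 * k) * (1 - qz i)
        + qz (c2 - m - n - \<alpha>2 * i + \<beta>2 * k) * (1 - qz n)
        + qz (c3 - n - 2 * i - \<alpha>3 * i + \<beta>3 * (k - 1)) * (1 - qz k)
      = qz (- \<alpha> * i + \<beta> * k) * (1 - qz (m + 1))"
  shows "trinom (m + 1) \<alpha> \<beta> l =
    qz c1 * trinom m \<alpha>1 \<beta>1 (l - 1) + qz c2 * trinom m \<alpha>2 \<beta>2 l + qz c3 * trinom m \<alpha>3 \<beta>3 (l + 1)"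
proof -
  have "tri_term (m + 1) \<alpha> \<beta> (k + l) k =
      qz c1 * tri_term m \<alpha>1 \<beta>1 (k + l - 1) k + qz c2 * tri_term m \<alpha>2 \<beta>2 (k + l) k
      + qz c3 * tri_term m \<alpha>3 \<beta>3 (k + l) (k - 1)" for k
  proof -
    define i where "i = k + l"
    define n where "n = m + 1 - i - k"
    define E where "E = (m + 1) * n + 2 * i * k"
    have m: "m = i + k + n - 1" by (simp add: n_def)
    have 1: "tri_term (m + 1) \<alpha> \<beta> i k = qz (E + (- \<alpha> * i + \<beta> * k)) * qmultinom i k n"
      unfolding tri_term_def E_def m
      by (intro arg_cong2[of _ _ _ _ "(*)"] arg_cong[of _ _ qz]) (simp_all add: algebra_simps)
    have 2: "qz c1 * tri_term m \<alpha>1 \<beta>1 (i - 1) k =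
        qz (E + (c1 - n - 2 * k - \<alpha>1 * (i - 1) + \<beta>1 * k)) * qmultinom (i - 1) k n"
      unfolding tri_term_def E_def m mult.assoc[symmetric] qz_add[symmetric]
      by (intro arg_cong2[of _ _ _ _ "(*)"] arg_cong[of _ _ qz]) (simp_all add: algebra_simps)
    have 3: "qz c2 * tri_term m \<alpha>2 \<beta>2 i k =
        qz (E + (c2 - m - n - \<alpha>2 * i + \<beta>2 * k)) * qmultinom i k (n - 1)"
      unfolding tri_term_def E_def m mult.assoc[symmetric] qz_add[symmetric]
      by (intro arg_cong2[of _ _ _ _ "(*)"] arg_cong[of _ _ qz]) (simp_all add: algebra_simps)
    have 4: "qz c3 * tri_term m \<alpha>3 \<beta>3 i (k - 1) =
        qz (E + (c3 - n - 2 * i - \<alpha>3 * i + \<beta>3 * (k - 1))) * qmultinom i (k - 1) n"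
      unfolding tri_term_def E_def m mult.assoc[symmetric] qz_add[symmetric]
      by (intro arg_cong2[of _ _ _ _ "(*)"] arg_cong[of _ _ qz]) (simp_all add: algebra_simps)
    have l: "i - k = l" and sum: "i + k + n = m + 1" by (simp_all add: i_def n_def)
    have gen: "e * a * x + e * b * y + e * c * z = e * d * w" if "a * x + b * y + c * z = d * w"
      for a b c d e x y z w :: qfield
      using arg_cong[OF that, of "\<lambda>x. e * x"] by (simp add: algebra_simps)
    show ?thesis
      unfolding i_def[symmetric] 1 2 3 4
    proof (rule qmultinom_pascal)
      show "i + k + n \<noteq> 0"
        using sum assms(1) by simp
    qed (unfold qz_add[of E] sum, rule gen, rule assms(2)[OF l sum])
  qed
  then show ?thesis
    unfolding trinom_same[of m _ _ l] trinom_upper trinom_lower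
    by (simp add: trinom_def sum.distrib sum_distrib_left)
qed

text \<open>With q to the power \<open>N * (k - i)\<close> divided out, the condition of
  \<open>trinom_step\<close> telescopes: through \<open>i\<close>, \<open>k\<close>,
  \<open>n\<close> in this order if \<open>\<alpha> = N\<close>, and through \<open>k\<close>,
  \<open>n\<close>, \<open>i\<close> if \<open>\<alpha> = N - 1\<close>.\<close>

lemma trinom_step_A:
  assumes "0 \<le> m" and "\<alpha> = N \<or> \<alpha> = N - 1"
  shows "trinom (m + 1) \<alpha> N l =
    qz (m * (N + 1) - (m + 1) * \<alpha>) * trinom m (N + 1) (N + 1) (l - 1) + qz (2 * m + 1) * trinom m N N l
    + qz ((m + 1) * N - m * (N - 1)) * trinom m (N - 2) (N - 1) (l + 1)"
proof (rule trinom_step[OF assms(1)])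
  fix i k n assume "i - k = l" "i + k + n = m + 1"
  then have m: "m = i + k + n - 1" by simp
  show "qz (m * (N + 1) - (m + 1) * \<alpha> - n - 2 * k - (N + 1) * (i - 1) + (N + 1) * k) * (1 - qz i)
      + qz (2 * m + 1 - m - n - N * i + N * k) * (1 - qz n)
      + qz ((m + 1) * N - m * (N - 1) - n - 2 * i - (N - 2) * i + (N - 1) * (k - 1)) * (1 - qz k)
    = qz (- \<alpha> * i + N * k) * (1 - qz (m + 1))"
    using assms(2) unfolding m by (auto simp: algebra_simps simp flip: qpow_add)
qed

text \<open>The mirror image: the telescoping runs through \<open>k\<close>, \<open>i\<close>,
  \<open>n\<close> if \<open>\<beta> = N\<close>, and through \<open>i\<close>, \<open>n\<close>,
  \<open>k\<close> if \<open>\<beta> = N + 1\<close>.\<close>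

lemma trinom_step_B:
  assumes "0 \<le> m" and "\<beta> = N \<or> \<beta> = N + 1"
  shows "trinom (m + 1) N \<beta> l =
    qz (m * (N + 1) - (m + 1) * N) * trinom m (N + 1) (N + 2) (l - 1) + qz (2 * m + 1) * trinom m N N l
    + qz ((m + 1) * \<beta> - m * (N - 1)) * trinom m (N - 1) (N - 1) (l + 1)"
proof (rule trinom_step[OF assms(1)])
  fix i k n assume "i - k = l" "i + k + n = m + 1"
  then have m: "m = i + k + n - 1" by simp
  show "qz (m * (N + 1) - (m + 1) * N - n - 2 * k - (N + 1) * (i - 1) + (N + 2) * k) * (1 - qz i)
      + qz (2 * m + 1 - m - n - N * i + N * k) * (1 - qz n)
      + qz ((m + 1) * \<beta> - m * (N - 1) - n - 2 * i - (N - 1) * i + (N - 1) * (k - 1)) * (1 - qz k)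
    = qz (- N * i + \<beta> * k) * (1 - qz (m + 1))"
    using assms(2) unfolding m by (auto simp: algebra_simps simp flip: qpow_add)
qed

text \<open>Both sides reduce, by two ratio identities each, to the same multiple of
  \<open>qmultinom i k (n - 2)\<close>. This relates \<open>H (k + 1)\<close> to the term at
  \<open>k\<close> in \<open>trinom_step_Two_aux\<close>.\<close>

lemma qmultinom_shift:
  "(1 - qz (i + 1)) * (1 - qz (k + 1)) * qmultinom (i + 1) (k + 1) (n - 2)
    = (1 - qz n) * (1 - qz (n - 1)) * qmultinom i k n"
proof -
  let ?a = "1 - qz (i + k + n)" and ?b = "1 - qz (i + k + n - 1)"
  have 1: "(1 - qz (i + 1)) * qmultinom (i + 1) (k + 1) (n - 2) = ?a * qmultinom i (k + 1) (n - 2)"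
    using qmultinom_pred_left[of "i + 1" "k + 1" "n - 2"] by (simp add: algebra_simps)
  have 2: "(1 - qz (k + 1)) * qmultinom i (k + 1) (n - 2) = ?b * qmultinom i k (n - 2)"
    using qmultinom_pred_mid[of i "k + 1" "n - 2"] by (simp add: algebra_simps)
  have 3: "(1 - qz n) * qmultinom i k n = ?a * qmultinom i k (n - 1)"
    using qmultinom_pred_right[of i k n] by simp
  have 4: "(1 - qz (n - 1)) * qmultinom i k (n - 1) = ?b * qmultinom i k (n - 2)"
    using qmultinom_pred_right[of i k "n - 1"] by (simp add: algebra_simps)
  have "(1 - qz (i + 1)) * (1 - qz (k + 1)) * qmultinom (i + 1) (k + 1) (n - 2)
      = (1 - qz (k + 1)) * (?a * qmultinom i (k + 1) (n - 2))"
    unfolding 1[symmetric] by (simp only: ac_simps)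
  also have "\<dots> = ?a * (?b * qmultinom i k (n - 2))"
    unfolding 2[symmetric] by (simp only: ac_simps)
  also have "\<dots> = (1 - qz (n - 1)) * (?a * qmultinom i k (n - 1))"
    unfolding 4[symmetric] by (simp only: ac_simps)
  also have "\<dots> = (1 - qz n) * (1 - qz (n - 1)) * qmultinom i k n"
    unfolding 3[symmetric] by (simp only: ac_simps)
  finally show ?thesis .
qed

text \<open>Raising \<beta> by one multiplies a term by \<open>qz k\<close>, and the factor
  \<open>qz k - 1\<close> is absorbed by lowering \<open>k\<close>; so the difference is a multiple
  of a q-trinomial for \<open>m\<close>.\<close>

lemma trinom_beta_diff:
  assumes "0 \<le> m"
  shows "trinom (m + 1) \<alpha> (\<beta> + 1) l =
    trinom (m + 1) \<alpha> \<beta> l + (qz (m + 1) - 1) * qz (m + \<beta>) * trinom m (\<alpha> - 1) (\<beta> - 1) (l + 1)"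
proof -
  have "tri_term (m + 1) \<alpha> (\<beta> + 1) (k + l) k = tri_term (m + 1) \<alpha> \<beta> (k + l) k
      + (qz (m + 1) - 1) * qz (m + \<beta>) * tri_term m (\<alpha> - 1) (\<beta> - 1) (k + l) (k - 1)" for k
  proof -
    define i where "i = k + l"
    define n where "n = m + 1 - i - k"
    define E where "E = (m + 1) * n + 2 * i * k - \<alpha> * i + \<beta> * k"
    have m: "m = i + k + n - 1" and mm: "m + 1 = i + k + n" by (simp_all add: n_def)
    have 1: "tri_term (m + 1) \<alpha> (\<beta> + 1) i k = qz (E + k) * qmultinom i k n"
      and 2: "tri_term (m + 1) \<alpha> \<beta> i k = qz E * qmultinom i k n"
      unfolding tri_term_def E_def m by (simp_all add: algebra_simps)
    have 3: "qz (m + \<beta>) * tri_term m (\<alpha> - 1) (\<beta> - 1) i (k - 1) = qz E * qmultinom i (k - 1) n"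
      unfolding tri_term_def E_def m mult.assoc[symmetric] qz_add[symmetric]
      by (intro arg_cong2[of _ _ _ _ "(*)"] arg_cong[of _ _ qz]) (simp_all add: algebra_simps)
    have "(qz (m + 1) - 1) * qz (m + \<beta>) * tri_term m (\<alpha> - 1) (\<beta> - 1) i (k - 1)
        = - qz E * ((1 - qz (m + 1)) * qmultinom i (k - 1) n)"
      unfolding mult.assoc 3 by (simp add: algebra_simps)
    also have "\<dots> = - qz E * ((1 - qz k) * qmultinom i k n)"
      unfolding mm qmultinom_pred_mid ..
    finally have "(qz (m + 1) - 1) * qz (m + \<beta>) * tri_term m (\<alpha> - 1) (\<beta> - 1) i (k - 1)
        = - qz E * ((1 - qz k) * qmultinom i k n)" .
    moreover have "a * b * d = a * d + c" if "c = - a * ((1 - b) * d)" for a b c d :: qfield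
      using that by (simp add: algebra_simps)
    ultimately show ?thesis
      unfolding i_def[symmetric] 1 2 qz_add[of E k] by blast
  qed
  then show ?thesis
    unfolding trinom_lower by (simp add: trinom_def sum.distrib sum_distrib_left)
qed

lemma trinom_alpha_diff:
  assumes "0 \<le> m"
  shows "trinom (m + 1) (\<alpha> - 1) \<beta> l =
    trinom (m + 1) \<alpha> \<beta> l + (qz (m + 1) - 1) * qz (m - \<alpha>) * trinom m (\<alpha> + 1) (\<beta> + 1) (l - 1)"
proof -
  have e: "- \<alpha> + 1 = - (\<alpha> - 1)" "- \<beta> - 1 = - (\<beta> + 1)" "- \<alpha> - 1 = - (\<alpha> + 1)"
    "- l + 1 = - (l - 1)" "m + - \<alpha> = m - \<alpha>"
    by simp_all
  show ?thesis
    using trinom_beta_diff[OF assms, of "- \<beta>" "- \<alpha>" "- l"] unfolding e trinom_reflect .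
qed

text \<open>The basic recursion at a site of type \<open>Two\<close>: \<open>N\<close> is its label
  and \<open>N - 2\<close> the label two steps below. The other weight pairs at such a site are
  derived from this one.\<close>

lemma trinom_step_Two_aux:
  assumes "0 \<le> m"
  shows "trinom (m + 1) (N - 1) N l =
    qz (m * (N + 1) - (m + 1) * (N - 1)) * trinom m (N + 1) (N + 1) (l - 1)
    + qz (m + 1) * trinom m (N - 1) N l
    + qz ((m + 1) * N - m * (N - 2)) * trinom m (N - 2) (N - 2) (l + 1)"
proof -
  let ?c1 = "m * (N + 1) - (m + 1) * (N - 1)" and ?c3 = "(m + 1) * N - m * (N - 2)"
  let ?Q = "1 - qz (m + 1)"
  \<comment> \<open>Not a termwise identity: the terms differ by the difference \<open>H (k + 1) - H k\<close>.\<close>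
  define H where "H k = qz ((m + 1) * (m + 1 - l - 2 * k) + 2 * (k + l) * k - (N - 1) * l + (m + 1 - l - k))
      * ((1 - qz (k + l)) * (1 - qz k) * qmultinom (k + l) k (m + 1 - l - 2 * k))" for k
  have H: "?Q * (tri_term (m + 1) (N - 1) N (k + l) k
      - (qz ?c1 * tri_term m (N + 1) (N + 1) (k + l - 1) k + qz (m + 1) * tri_term m (N - 1) N (k + l) k
        + qz ?c3 * tri_term m (N - 2) (N - 2) (k + l) (k - 1))) = - (H (k + 1) - H k)" for k
  proof -
    define i where "i = k + l"
    define n where "n = m + 1 - i - k"
    define E where "E = (m + 1) * n + 2 * i * k - (N - 1) * (i - k)"
    have m: "m = i + k + n - 1" and l: "l = i - k" by (simp_all add: n_def i_def)
    have 1: "tri_term (m + 1) (N - 1) N i k = qz (E + k) * qmultinom i k n"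
      unfolding tri_term_def E_def m
      by (intro arg_cong2[of _ _ _ _ "(*)"] arg_cong[of _ _ qz]) (simp_all add: algebra_simps)
    have 2: "qz ?c1 * tri_term m (N + 1) (N + 1) (i - 1) k = qz (E + n + 2 * k) * qmultinom (i - 1) k n"
      unfolding tri_term_def E_def m mult.assoc[symmetric] qz_add[symmetric]
      by (intro arg_cong2[of _ _ _ _ "(*)"] arg_cong[of _ _ qz]) (simp_all add: algebra_simps)
    have 3: "qz (m + 1) * tri_term m (N - 1) N i k = qz (E + k + 1 - n) * qmultinom i k (n - 1)"
      unfolding tri_term_def E_def m mult.assoc[symmetric] qz_add[symmetric]
      by (intro arg_cong2[of _ _ _ _ "(*)"] arg_cong[of _ _ qz]) (simp_all add: algebra_simps)
    have 4: "qz ?c3 * tri_term m (N - 2) (N - 2) i (k - 1) = qz (E + i + k + n) * qmultinom i (k - 1) n"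
      unfolding tri_term_def E_def m mult.assoc[symmetric] qz_add[symmetric]
      by (intro arg_cong2[of _ _ _ _ "(*)"] arg_cong[of _ _ qz]) (simp_all add: algebra_simps)
    have 5: "H k = qz (E + n + k) * ((1 - qz i) * (1 - qz k) * qmultinom i k n)"
      unfolding H_def E_def m l
      by (intro arg_cong2[of _ _ _ _ "(*)"] arg_cong[of _ _ qz]) (simp_all add: algebra_simps)
    have "H (k + 1) = qz (E + k + 1 - n) * ((1 - qz (i + 1)) * (1 - qz (k + 1)) * qmultinom (i + 1) (k + 1) (n - 2))"
      unfolding H_def E_def m l
      by (intro arg_cong2[of _ _ _ _ "(*)"] arg_cong[of _ _ qz]) (simp_all add: algebra_simps)
    then have 6: "H (k + 1) = qz (E + k + 1 - n) * ((1 - qz n) * (1 - qz (n - 1)) * qmultinom i k n)"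
      unfolding qmultinom_shift .
    have mm: "m + 1 = i + k + n" by (simp add: m)
    have gen1: "Q * (a * x - (b * y + c * z + d * w)) = a * (Q * x) - (b * (Q * y) + c * (Q * z) + d * (Q * w))"
      and gen2: "a * (Q * x) - (b * (y * x) + c * (z * x) + d * (w * x)) = (a * Q - (b * y + c * z + d * w)) * x"
      and gen3: "- (a * (y * z) - b * (w * c)) * x = - (a * (y * z * x) - b * (w * c * x))"
      for Q a b c d x y z w :: qfield
      by (simp_all add: algebra_simps)
    have "?Q * (tri_term (m + 1) (N - 1) N i k
      - (qz ?c1 * tri_term m (N + 1) (N + 1) (i - 1) k + qz (m + 1) * tri_term m (N - 1) N i k
        + qz ?c3 * tri_term m (N - 2) (N - 2) i (k - 1)))
      = qz (E + k) * (?Q * qmultinom i k n)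
        - (qz (E + n + 2 * k) * (?Q * qmultinom (i - 1) k n) + qz (E + k + 1 - n) * (?Q * qmultinom i k (n - 1))
          + qz (E + i + k + n) * (?Q * qmultinom i (k - 1) n))"
      unfolding 1 2 3 4 by (rule gen1)
    also have "\<dots> = (qz (E + k) * (1 - qz (i + k + n))
        - (qz (E + n + 2 * k) * (1 - qz i) + qz (E + k + 1 - n) * (1 - qz n)
          + qz (E + i + k + n) * (1 - qz k))) * qmultinom i k n"
      unfolding mm qmultinom_pred_left qmultinom_pred_mid qmultinom_pred_right
      by (rule gen2)
    \<comment> \<open>The bracket separates into two products: one becomes \<open>H (k + 1)\<close>
      through \<open>qmultinom_shift\<close>, the other is \<open>H k\<close>.\<close>
    also have "qz (E + k) * (1 - qz (i + k + n))
        - (qz (E + n + 2 * k) * (1 - qz i) + qz (E + k + 1 - n) * (1 - qz n)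
          + qz (E + i + k + n) * (1 - qz k))
      = - (qz (E + k + 1 - n) * ((1 - qz n) * (1 - qz (n - 1))) - qz (E + n + k) * ((1 - qz i) * (1 - qz k)))"
      by (simp add: algebra_simps flip: qpow_add)
    also have "\<dots> * qmultinom i k n = - (H (k + 1) - H k)"
      unfolding 5 6 by (rule gen3)
    finally show ?thesis
      unfolding i_def[symmetric] .
  qed
  have tel: "(\<Sum>k\<in>{0..int j}. H (k + 1) - H k) = H (int j + 1) - H 0" for j
    by (induction j) (simp_all add: atLeastAtMostPlus1_int_conv algebra_simps)
  have "H 0 = 0"
    by (simp add: H_def qpow_0)
  moreover have "H (m + 1 + 1) = 0"
  proof -
    \<comment> \<open>The first and the third argument add up to -1, so one of them is
      negative.\<close>
    have "qmultinom (m + 1 + 1 + l) (m + 1 + 1) (m + 1 - l - 2 * (m + 1 + 1)) = 0"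
      unfolding qmultinom_def by (rule if_not_P) arith
    then show ?thesis by (simp only: H_def mult_zero_right)
  qed
  ultimately have "(\<Sum>k\<in>{0..m + 1}. H (k + 1) - H k) = 0"
    using tel[of "nat (m + 1)"] assms by simp
  then have "?Q * (trinom (m + 1) (N - 1) N l - (qz ?c1 * trinom m (N + 1) (N + 1) (l - 1)
      + qz (m + 1) * trinom m (N - 1) N l + qz ?c3 * trinom m (N - 2) (N - 2) (l + 1))) = 0"
    unfolding trinom_same[of m _ _ l] trinom_upper trinom_lower trinom_def[of "m + 1"]
    by (simp only: sum_distrib_left sum.distrib[symmetric] sum_subtractf[symmetric] H sum_negf minus_zero)
  moreover have "?Q \<noteq> 0"
    using qz_eq_1_iff[of "m + 1"] assms by auto
  ultimately show ?thesis
    by simp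
qed

text \<open>Passing from the weights (\<open>N - 1\<close>, \<open>N\<close>) to equal weights
  changes the left side, by \<open>trinom_beta_diff\<close> or \<open>trinom_alpha_diff\<close>,
  exactly as it changes the power of q in front of one outer summand.\<close>

lemma trinom_step_Two:
  assumes "0 \<le> m" and "(\<alpha>, \<beta>) \<in> {(N - 1, N), (N - 1, N - 1), (N, N)}"
  shows "trinom (m + 1) \<alpha> \<beta> l =
    qz (m * (N + 1) - (m + 1) * \<alpha>) * trinom m (N + 1) (N + 1) (l - 1)
    + qz (m + 1) * trinom m (N - 1) N l
    + qz ((m + 1) * \<beta> - m * (N - 2)) * trinom m (N - 2) (N - 2) (l + 1)"
proof -
  have e: "m * (N + 1) - (m + 1) * N = m - N"
    "m * (N + 1) - (m + 1) * (N - 1) = (m + 1) + (m - N)"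
    "(m + 1) * N - m * (N - 2) = (m + 1) + (m + (N - 1))"
    "(m + 1) * (N - 1) - m * (N - 2) = m + (N - 1)"
    "N - 1 + 1 = N" "N - 1 - 1 = N - 2"
    by (simp_all add: algebra_simps)
  have gen: "T = A + B + x * X" if "T' = T + (y - 1) * x * X" "T' = A + B + (y * x) * X"
    for T T' A B x X y :: qfield
    using that by (simp add: algebra_simps)
  have gen': "T = x * X + B + A" if "T' = T + (y - 1) * x * X" "T' = (y * x) * X + B + A"
    for T T' A B x X y :: qfield
    using that by (simp add: algebra_simps)
  note aux = trinom_step_Two_aux[OF assms(1), of N l]
  have "trinom (m + 1) (N - 1) (N - 1) l =
    qz (m * (N + 1) - (m + 1) * (N - 1)) * trinom m (N + 1) (N + 1) (l - 1)
    + qz (m + 1) * trinom m (N - 1) N l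
    + qz ((m + 1) * (N - 1) - m * (N - 2)) * trinom m (N - 2) (N - 2) (l + 1)"
    using trinom_beta_diff[OF assms(1), of "N - 1" "N - 1" l] aux
    unfolding e(3-6) qz_add[of "m + 1" "m + (N - 1)"] by (rule gen)
  moreover have "trinom (m + 1) N N l =
    qz (m * (N + 1) - (m + 1) * N) * trinom m (N + 1) (N + 1) (l - 1)
    + qz (m + 1) * trinom m (N - 1) N l
    + qz ((m + 1) * N - m * (N - 2)) * trinom m (N - 2) (N - 2) (l + 1)"
    using trinom_alpha_diff[OF assms(1), of N N l] aux
    unfolding e(1) e(2) qz_add[of "m + 1" "m - N"] by (rule gen')
  ultimately show ?thesis
    using assms(2) aux by auto
qed

section \<open>Alternating sums of \<open>q\<close>-trinomials\<close>

lemma trinom_shift: "trinom m (\<alpha> + c) (\<beta> + c) l = qz (- c * l) * trinom m \<alpha> \<beta> l"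
  unfolding trinom_def sum_distrib_left tri_term_def mult.assoc[symmetric] qz_add[symmetric]
  by (intro sum.cong refl arg_cong2[of _ _ _ _ "(*)"] arg_cong[of _ _ qz]) (simp_all add: algebra_simps)

text \<open>The images of \<open>b\<close> under translations by multiples of \<open>2 * p'\<close>.
  Truncating at \<open>K\<close> keeps the sum finite; \<open>K\<close> is later taken so large that
  the discarded terms vanish.\<close>

definition theta_sum :: "int \<Rightarrow> int \<Rightarrow> int \<Rightarrow> int \<Rightarrow> int \<Rightarrow> int \<Rightarrow> int \<Rightarrow> int \<Rightarrow> qfield" where
  "theta_sum K p p' a m \<alpha> \<beta> b =
     (\<Sum>j\<in>{-K..K}. qz (j\<^sup>2 * p * p' - j * p * a) * trinom m \<alpha> \<beta> ((a - b) div 2 - p' * j))"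

text \<open>The method of images: the reflection in 0, which takes \<open>b\<close> to
  \<open>- b\<close> and the weights (\<alpha>, \<beta>) to (-\<beta>, -\<alpha>), enters with a
  minus sign.\<close>

definition altsum :: "int \<Rightarrow> int \<Rightarrow> int \<Rightarrow> int \<Rightarrow> int \<Rightarrow> int \<Rightarrow> int \<Rightarrow> int \<Rightarrow> qfield" where
  "altsum K p p' a m \<alpha> \<beta> b =
     theta_sum K p p' a m \<alpha> \<beta> b - theta_sum K p p' a m (- \<beta>) (- \<alpha>) (- b)"

lemma altsum_reflect: "altsum K p p' a m (- \<beta>) (- \<alpha>) (- b) = - altsum K p p' a m \<alpha> \<beta> b"
  by (simp add: altsum_def)

text \<open>The translation shifts \<open>j\<close> by one; the power of q collects the change of
  the quadratic exponent and the factor from \<open>trinom_shift\<close>.\<close>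

lemma theta_sum_period:
  assumes "m + \<bar>a\<bar> + \<bar>b\<bar> < K" and "0 < p'" and "even (a - b)"
  shows "theta_sum K p p' a m (\<alpha> + 2 * p) (\<beta> + 2 * p) (b + 2 * p') =
    qz (p * p' + p * b) * theta_sum K p p' a m \<alpha> \<beta> b"
proof -
  define F where "F j = qz (p * p' + p * b) *
    (qz (j\<^sup>2 * p * p' - j * p * a) * trinom m \<alpha> \<beta> ((a - b) div 2 - p' * j))" for j
  \<comment> \<open>The terms at the ends of the range vanish, so shifting the range by one does not
    change the sum.\<close>
  have F0: "F j = 0" if "K \<le> \<bar>j\<bar>" for j
  proof -
    have "K \<le> p' * \<bar>j\<bar>"
      using mult_right_mono[of 1 p' "\<bar>j\<bar>"] assms(2) that by simp
    moreover have "p' * \<bar>j\<bar> = \<bar>p' * j\<bar>"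
      using assms(2) by (simp add: abs_mult)
    ultimately have "m < \<bar>(a - b) div 2 - p' * j\<bar>"
      using assms(1) by linarith
    then show ?thesis
      by (simp add: F_def trinom_eq_0)
  qed
  obtain c where c: "a - b = 2 * c"
    using assms(3) by blast
  have d: "(a - (b + 2 * p')) div 2 = c - p'" "(a - b) div 2 = c"
    using c by simp_all
  have b: "b = a - 2 * c"
    using c by simp
  have "theta_sum K p p' a m (\<alpha> + 2 * p) (\<beta> + 2 * p) (b + 2 * p') = (\<Sum>j\<in>{-K..K}. F (j + 1))"
    unfolding theta_sum_def F_def trinom_shift d mult.assoc[symmetric] qz_add[symmetric]
    by (intro sum.cong refl arg_cong2[of _ _ _ _ "(*)"] arg_cong[of _ _ qz] arg_cong[of _ _ "trinom m \<alpha> \<beta>"])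
      (simp_all add: b algebra_simps power2_eq_square)
  also have "\<dots> = (\<Sum>j\<in>{-K+1..K+1}. F j)"
    by (rule sum.reindex_bij_witness[of _ "\<lambda>j. j - 1" "\<lambda>j. j + 1"]) auto
  also have "\<dots> = (\<Sum>j\<in>{-K..K+1}. F j)"
    by (intro sum.mono_neutral_left) (auto intro: F0)
  also have "\<dots> = (\<Sum>j\<in>{-K..K}. F j)"
    by (intro sum.mono_neutral_right) (auto intro: F0)
  also have "\<dots> = qz (p * p' + p * b) * theta_sum K p p' a m \<alpha> \<beta> b"
    by (simp add: F_def theta_sum_def sum_distrib_left)
  finally show ?thesis .
qed

section \<open>The two walls of the strip\<close>

lemma altsum_origin: "altsum K p p' a m 0 0 0 = 0"
  by (simp add: altsum_def)

text \<open>The reflected label \<open>- p'\<close> with weights \<open>- p\<close> returns to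
  \<open>p'\<close> with weights \<open>p\<close> under one translation, here with the factor
  1.\<close>

lemma altsum_end:
  assumes "m + \<bar>a\<bar> + p' < K" and "0 < p'" and "even (a - p')"
  shows "altsum K p p' a m p p p' = 0"
  using theta_sum_period[of m a "- p'" K p' p "- p" "- p"] assms
  by (simp add: altsum_def qpow_0)

text \<open>Reflection in 0 followed by one translation is the reflection in \<open>p'\<close>: it
  exchanges \<open>p' + 1\<close> and \<open>p' - 1\<close> together with the weights
  (\<open>p\<close>, \<open>p + 1\<close>) and (\<open>p - 1\<close>, \<open>p\<close>).\<close>

lemma altsum_end_reflect:
  assumes "m + \<bar>a\<bar> + p' + 1 < K" and "0 < p'" and "even (a - (p' - 1))"
  shows "altsum K p p' a m p (p + 1) (p' + 1) = - qz p * altsum K p p' a m (p - 1) p (p' - 1)"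
proof -
  have e: "even (a - (1 - p'))" "even (a - (- p' - 1))"
    using assms(3) by presburger+
  have 1: "theta_sum K p p' a m p (p + 1) (p' + 1) = qz p * theta_sum K p p' a m (- p) (1 - p) (1 - p')"
    using theta_sum_period[of m a "1 - p'" K p' p "- p" "1 - p"] assms e
    by (simp add: algebra_simps)
  have 2: "theta_sum K p p' a m (p - 1) p (p' - 1) = qz (- p) * theta_sum K p p' a m (- p - 1) (- p) (- p' - 1)"
    using theta_sum_period[of m a "- p' - 1" K p' p "- p - 1" "- p"] assms e
    by (simp add: algebra_simps)
  have 3: "qz p * (qz (- p) * x) = x" for x
    by (simp add: mult.assoc[symmetric] qpow_add[symmetric] qpow_0)
  have 4: "- (p + 1) = - p - 1" "- (p - 1) = 1 - p" "- (p' + 1) = - p' - 1" "- (p' - 1) = 1 - p'"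
    by simp_all
  show ?thesis
    unfolding altsum_def 4 1 2 by (simp only: right_diff_distrib mult_minus_left 3) (simp add: algebra_simps)
qed

text \<open>At length 0 only images of \<open>b\<close> equal to \<open>a\<close> count; inside the
  strip that can only be \<open>b\<close> itself.\<close>

lemma altsum_0:
  assumes "0 \<le> K" and "1 \<le> a" "a \<le> p' - 1" and "1 \<le> b" "b \<le> p' - 1" and "even (a - b)"
  shows "altsum K p p' a 0 \<alpha> \<beta> b = (if a = b then 1 else 0)"
proof -
  have 1: "(a - b) div 2 - p' * j = 0 \<longleftrightarrow> a = b \<and> j = 0" for j
  proof
    assume *: "(a - b) div 2 - p' * j = 0"
    then have "(a - b) div 2 = p' * j" by simp
    moreover have "2 * ((a - b) div 2) = a - b" using assms(6) by (rule dvd_mult_div_cancel)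
    ultimately have **: "a - b = p' * (2 * j)" by (simp only: mult.left_commute)
    have "j = 0"
    proof (rule ccontr)
      assume "j \<noteq> 0"
      then have "p' * 1 \<le> p' * \<bar>2 * j\<bar>" using assms by (intro mult_left_mono) auto
      also have "\<dots> = \<bar>a - b\<bar>" unfolding ** using assms by (simp add: abs_mult)
      finally show False using assms by linarith
    qed
    then show "a = b \<and> j = 0" using ** by simp
  qed auto
  have 2: "(a - - b) div 2 - p' * j \<noteq> 0" for j
  proof
    assume *: "(a - - b) div 2 - p' * j = 0"
    have "even (a + b)" using assms(6) by presburger
    then have "2 * ((a + b) div 2) = a + b" by (rule dvd_mult_div_cancel)
    moreover have "(a + b) div 2 = p' * j" using * by simp
    ultimately have **: "a + b = 2 * (p' * j)" by simp
    then have "0 < p' * j" "p' * j < p' * 1" using assms by linarith+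
    then have "0 < j" "j < 1"
      using assms by (simp_all add: zero_less_mult_iff)
    then show False by simp
  qed
  have "theta_sum K p p' a 0 \<alpha> \<beta> b = (if a = b then 1 else 0)"
    unfolding theta_sum_def trinom_0 1 using assms(1)
    by (auto simp: qpow_0 if_distrib[of "\<lambda>x. _ * x"] cong: if_cong)
  moreover have "theta_sum K p p' a 0 (- \<beta>) (- \<alpha>) (- b) = 0"
    unfolding theta_sum_def trinom_0 using 2 by (intro sum.neutral) auto
  ultimately show ?thesis
    by (simp add: altsum_def)
qed

text \<open>By \<open>trinom_reflect\<close> the reflected images can be written with the original
  weights, so a recursion valid for all \<open>l\<close> applies to every image at once.\<close>

lemma altsum_step:
  assumes "\<And>l. trinom (m + 1) \<alpha> \<beta> l =
    c1 * trinom m \<alpha>1 \<beta>1 (l - 1) + c2 * trinom m \<alpha>2 \<beta>2 l + c3 * trinom m \<alpha>3 \<beta>3 (l + 1)"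
  shows "altsum K p p' a (m + 1) \<alpha> \<beta> b =
    c1 * altsum K p p' a m \<alpha>1 \<beta>1 (b + 2) + c2 * altsum K p p' a m \<alpha>2 \<beta>2 b
    + c3 * altsum K p p' a m \<alpha>3 \<beta>3 (b - 2)"
proof -
  have altsum_eq: "altsum K p p' a m \<alpha> \<beta> b = (\<Sum>j\<in>{-K..K}. qz (j\<^sup>2 * p * p' - j * p * a) *
      (trinom m \<alpha> \<beta> ((a - b) div 2 - p' * j) - trinom m \<alpha> \<beta> (p' * j - (a + b) div 2)))"
    for m \<alpha> \<beta> b
    using trinom_reflect[of m \<beta> \<alpha> "p' * _ - (a + b) div 2"]
    by (simp add: altsum_def theta_sum_def right_diff_distrib sum_subtractf)
  have d: "(a - (b + 2)) div 2 - x = (a - b) div 2 - x - 1" "x - (a + (b + 2)) div 2 = x - (a + b) div 2 - 1"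
    "(a - (b - 2)) div 2 - x = (a - b) div 2 - x + 1" "x - (a + (b - 2)) div 2 = x - (a + b) div 2 + 1"
    for x by simp_all
  have gen: "e * (c1 * x1 + c2 * y1 + c3 * z1 - (c1 * x2 + c2 * y2 + c3 * z2)) =
      c1 * (e * (x1 - x2)) + c2 * (e * (y1 - y2)) + c3 * (e * (z1 - z2))"
    for e x1 y1 z1 x2 y2 z2 :: qfield
    by (simp add: algebra_simps)
  show ?thesis
    unfolding altsum_eq d assms gen by (simp only: sum.distrib sum_distrib_left)
qed

text \<open>This relation makes the level step 1 -> 1 and the step from -1, both absent from paths,
  cancel. By induction they cancel in the recursion of either side, and the remaining inner terms
  differ by the required power of q.\<close>

lemma altsum_left_boundary: "altsum K p p' a (int m) 0 1 1 = qz (int m) * altsum K p p' a (int m) 1 1 1"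
proof (induction m)
  case 0
  then show ?case
    by (simp add: altsum_def theta_sum_def trinom_0 qpow_0)
next
  case (Suc m)
  let ?Z = "altsum K p p' a (int m)"
  have "?Z (- 1) 0 (- 1) = - (qz (int m) * ?Z 1 1 1)"
    using altsum_reflect[of K p p' a "int m" 1 0 1] Suc by simp
  then have 0: "qz (2 * int m + 1) * ?Z 1 1 1 + qz (int m + 1) * ?Z (- 1) 0 (- 1) = 0"
    by (simp add: algebra_simps flip: qpow_add)
  have step: "altsum K p p' a (int m + 1) \<alpha> 1 1 = qz (int m * 2 - (int m + 1) * \<alpha>) * ?Z 2 2 3"
    if "\<alpha> = 1 \<or> \<alpha> = 1 - 1" for \<alpha>
    using altsum_step[of "int m" \<alpha> 1, OF trinom_step_A[OF _ that], of K p p' a 1] 0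
    by (simp add: add.assoc)
  show ?case
    using step[of 0] step[of 1] by (simp add: algebra_simps flip: qpow_add)
qed

text \<open>The mirror image at \<open>p' - 1\<close>, with \<open>altsum_end_reflect\<close> in
  place of the reflection in 0 and the recursion \<open>trinom_step_B\<close> for the label
  \<open>p - 1\<close>.\<close>

lemma altsum_right_boundary:
  assumes "int m + \<bar>a\<bar> + p' + 1 < K" and "0 < p'" and "even (a - (p' - 1))"
  shows "altsum K p p' a (int m) (p - 1) p (p' - 1) =
    qz (int m) * altsum K p p' a (int m) (p - 1) (p - 1) (p' - 1)"
  using assms(1)
proof (induction m)
  case 0
  then show ?case
    by (simp add: altsum_def theta_sum_def trinom_0 qpow_0)
next
  case (Suc m)
  let ?Z = "altsum K p p' a (int m)"
  have IH: "?Z (p - 1) p (p' - 1) = qz (int m) * ?Z (p - 1) (p - 1) (p' - 1)"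
    using Suc by simp
  have e: "int m + 1 - p + p + int m = 2 * int m + 1" by simp
  have "?Z p (p + 1) (p' + 1) = - (qz p * (qz (int m) * ?Z (p - 1) (p - 1) (p' - 1)))"
    using altsum_end_reflect[of "int m" a p' K p] assms(2,3) Suc IH by simp
  then have 0: "qz (int m + 1 - p) * ?Z p (p + 1) (p' + 1)
      + qz (2 * int m + 1) * ?Z (p - 1) (p - 1) (p' - 1) = 0"
    unfolding e[symmetric] qz_add by (simp add: mult.assoc)
  have step: "altsum K p p' a (int m + 1) (p - 1) \<beta> (p' - 1) =
      qz ((int m + 1) * \<beta> - int m * (p - 2)) * ?Z (p - 2) (p - 2) (p' - 3)"
    if "\<beta> = p - 1 \<or> \<beta> = p - 1 + 1" for \<beta>
  proof -
    have e: "p - 1 + 1 = p" "p - 1 + 2 = p + 1" "p - 1 - 1 = p - 2" "p' - 1 + 2 = p' + 1" "p' - 1 - 2 = p' - 3"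
      "int m * p - (int m + 1) * (p - 1) = int m + 1 - p"
      by (simp_all add: algebra_simps)
    have "0 \<le> int m" by simp
    from altsum_step[of "int m" "p - 1" \<beta>, OF trinom_step_B[OF this that], of K p p' a "p' - 1"]
    show ?thesis
      unfolding e 0 by simp
  qed
  have e: "int m + 1 + ((int m + 1) * (p - 1) - int m * (p - 2)) = (int m + 1) * p - int m * (p - 2)"
    by (simp add: algebra_simps)
  have "altsum K p p' a (int m + 1) (p - 1) p (p' - 1) =
      qz (int m + 1) * altsum K p p' a (int m + 1) (p - 1) (p - 1) (p' - 1)"
    using step[of p] step[of "p - 1"] unfolding e[symmetric] qz_add by (simp add: mult.assoc)
  then show ?case
    by (simp add: add.commute)
qed

section \<open>Identification with \<open>S_sum\<close> and \<open>I_sum\<close>\<close>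

lemma qfact_add: "qfact (n + k) = qfact n * qpoch (qpow (of_nat (n + 1))) k"
proof (induction k)
  case 0
  then show ?case by (simp add: qpoch_def)
next
  case (Suc k)
  have "qfact (n + Suc k) = (1 - qpow (of_nat k) * qpow (of_nat (n + 1))) * qfact (n + k)"
    by (simp add: qfact_Suc algebra_simps flip: qpow_add)
  then show ?case
    by (simp add: Suc qpoch_def)
qed

lemma qbinom_eq:
  assumes "0 \<le> k" and "k \<le> n"
  shows "qbinom n k = qfact (nat n) / (qfact (nat k) * qfact (nat (n - k)))"
proof -
  have "nat n = nat (n - k) + nat k" "(of_int (n - k + 1) :: rat) = of_nat (nat (n - k) + 1)"
    using assms by simp_all
  then show ?thesis
    using assms by (simp only: qbinom_def qfact_add if_True) (simp add: qfact_nonzero)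
qed

lemma qbinom_mult_qbinom: "qbinom (int m) \<nu> * qbinom \<nu> k = qmultinom (int m - \<nu>) k (\<nu> - k)"
proof (cases "0 \<le> \<nu> \<and> \<nu> \<le> int m \<and> 0 \<le> k \<and> k \<le> \<nu>")
  case True
  then show ?thesis
    by (simp add: qbinom_eq qmultinom_def qfact_nonzero)
next
  case False
  then have "qbinom (int m) \<nu> = 0 \<or> qbinom \<nu> k = 0"
    using qbinom_eq_0[of "int m" \<nu>] qbinom_eq_0[of \<nu> k] by (auto simp: qbinom_def)
  then show ?thesis
    using False by (auto simp: qmultinom_def)
qed

text \<open>The substitution \<open>\<nu> = m - i\<close>, with \<open>i = k + l\<close>, turns the
  product of q-binomials into the q-multinomial coefficient of (\<open>i\<close>, \<open>k\<close>,
  \<open>m - i - k\<close>).\<close>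

lemma S_sum_eq_trinom: "qz ((int m)\<^sup>2 - l\<^sup>2) * S_sum m l = trinom (int m) 0 0 l"
proof -
  let ?f = "\<lambda>\<nu>. qpow (of_int ((\<nu> + l - int m) * (\<nu> + l) + \<nu> * (\<nu> - int m)))
          * qbinom (int m) \<nu> * qbinom \<nu> (int m - l - \<nu>)"
  let ?A = "{- l - \<bar>l\<bar>..2 * int m - l + \<bar>l\<bar>}" and ?B = "{- int m - \<bar>l\<bar>..int m + \<bar>l\<bar>}"
  have "S_sum m l = sum ?f ?A"
    unfolding S_sum_def
  proof (rule Sum_any.expand_superset)
    show "{\<nu>. ?f \<nu> \<noteq> 0} \<subseteq> ?A"
    proof
      fix \<nu> assume "\<nu> \<in> {\<nu>. ?f \<nu> \<noteq> 0}"
      then have "qbinom (int m) \<nu> * qbinom \<nu> (int m - l - \<nu>) \<noteq> 0"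
        by (auto simp: mult.assoc)
      from qbinom_product_support(1,2)[OF this] show "\<nu> \<in> ?A"
        by auto
    qed
  qed simp
  also have "\<dots> = (\<Sum>k\<in>?B. ?f (int m - l - k))"
    by (rule sum.reindex_bij_witness[of _ "\<lambda>k. int m - l - k" "\<lambda>\<nu>. int m - l - \<nu>"]) auto
  finally have "qz ((int m)\<^sup>2 - l\<^sup>2) * S_sum m l = (\<Sum>k\<in>?B. qz ((int m)\<^sup>2 - l\<^sup>2) * ?f (int m - l - k))"
    by (simp add: sum_distrib_left)
  also have "\<dots> = (\<Sum>k\<in>?B. tri_term (int m) 0 0 (k + l) k)"
    unfolding tri_term_def mult.assoc qbinom_mult_qbinom
    unfolding mult.assoc[symmetric] qz_add[symmetric]
    by (intro sum.cong refl arg_cong2[of _ _ _ _ "(*)"] arg_cong[of _ _ qz])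
      (simp_all add: algebra_simps power2_eq_square)
  also have "\<dots> = trinom (int m) 0 0 l"
    by (subst trinom_superset[of ?B]) auto
  finally show ?thesis .
qed

text \<open>For equal weights \<open>r\<close>, and \<open>- r\<close> in the reflected part,
  \<open>trinom_shift\<close> supplies the terms of the exponents that are linear in
  \<open>r\<close>, up to the common factor in front.\<close>

lemma I_sum_eq_altsum:
  assumes "int m + \<bar>a\<bar> + \<bar>b\<bar> < K" and "0 < p'" and "even (a - b)"
  shows "I_sum p p' r a b m = qz (r * ((a - b) div 2)) * altsum K p p' a (int m) r r b"
proof -
  obtain c where c: "a - b = 2 * c"
    using assms(3) by blast
  then have a: "a = b + 2 * c"
    by simp
  have d: "(a - b) div 2 = c" "(a + b) div 2 = b + c" "(a - - b) div 2 = b + c"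
    by (simp_all add: a)
  have tri: "trinom (int m) r r l = qz (- r * l) * trinom (int m) 0 0 l" for r l
    using trinom_shift[of "int m" 0 r 0 l] by simp
  have zero: "S_sum m (x - p' * n) = 0" if "K \<le> \<bar>n\<bar>" "\<bar>x\<bar> \<le> \<bar>a\<bar> + \<bar>b\<bar>" for x n
  proof (rule S_sum_eq_0)
    have "K \<le> p' * \<bar>n\<bar>"
      using mult_right_mono[of 1 p' "\<bar>n\<bar>"] assms(2) that by simp
    moreover have "p' * \<bar>n\<bar> = \<bar>p' * n\<bar>"
      using assms(2) by (simp add: abs_mult)
    ultimately show "int m < \<bar>x - p' * n\<bar>"
      using assms(1) that(2) by linarith
  qed
  have bound: "\<bar>c\<bar> \<le> \<bar>a\<bar> + \<bar>b\<bar>" "\<bar>b + c\<bar> \<le> \<bar>a\<bar> + \<bar>b\<bar>"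
    using c by linarith+
  let ?e1 = "\<lambda>n. n^2 * p * p' + n * (p' * r - p * a) + (int m)^2 - (c - p' * n)^2"
  let ?e2 = "\<lambda>n. n^2 * p * p' + n * (p' * r + p * a) + r * a + (int m)^2 - (b + c + p' * n)^2"
  have "(\<Sum>n. qz (?e1 n) * S_sum m (c - p' * n)) = (\<Sum>n\<in>{-K..K}. qz (?e1 n) * S_sum m (c - p' * n))"
    using zero[OF _ bound(1)] by (intro Sum_any.expand_superset) force+
  also have "\<dots> = qz (r * c) * theta_sum K p p' a (int m) r r b"
    unfolding theta_sum_def d tri S_sum_eq_trinom[symmetric] sum_distrib_left
    unfolding mult.assoc[symmetric] qz_add[symmetric]
    by (intro sum.cong refl arg_cong2[of _ _ _ _ "(*)"] arg_cong[of _ _ qz])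
      (simp_all add: algebra_simps power2_eq_square)
  finally have 1: "(\<Sum>n. qz (?e1 n) * S_sum m (c - p' * n)) = qz (r * c) * theta_sum K p p' a (int m) r r b" .
  have "(\<Sum>n. qz (?e2 n) * S_sum m (b + c + p' * n)) = (\<Sum>n\<in>{-K..K}. qz (?e2 n) * S_sum m (b + c + p' * n))"
    using zero[OF _ bound(2), of "- _"] by (intro Sum_any.expand_superset) force+
  \<comment> \<open>\<open>I_sum\<close> and \<open>theta_sum\<close> run through the reflected
    images in opposite directions.\<close>
  also have "\<dots> = (\<Sum>n\<in>{-K..K}. qz (?e2 (- n)) * S_sum m (b + c - p' * n))"
    by (rule sum.reindex_bij_witness[of _ uminus uminus]) auto
  also have "\<dots> = qz (r * c) * theta_sum K p p' a (int m) (- r) (- r) (- b)"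
    unfolding theta_sum_def d tri S_sum_eq_trinom[symmetric] sum_distrib_left
    unfolding mult.assoc[symmetric] qz_add[symmetric]
    by (intro sum.cong refl arg_cong2[of _ _ _ _ "(*)"] arg_cong[of _ _ qz])
      (simp_all add: a algebra_simps power2_eq_square)
  finally have 2: "(\<Sum>n. qz (?e2 n) * S_sum m (b + c + p' * n)) = qz (r * c) * theta_sum K p p' a (int m) (- r) (- r) (- b)" .
  show ?thesis
    unfolding I_sum_def altsum_def d 1 2 by (simp only: right_diff_distrib)
qed

section \<open>Path sums\<close>

definition allowed :: "int \<Rightarrow> int \<Rightarrow> int \<Rightarrow> bool" where
  "allowed p' d b \<longleftrightarrow> 1 \<le> d \<and> d \<le> p' - 1 \<and> \<not> (d = b \<and> (b = 1 \<or> b = p' - 1))"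

lemma paths_0: "paths p' a b 0 = (if a = b \<and> 1 \<le> a \<and> a \<le> p' - 1 then {[a]} else {})"
  by (auto simp: paths_def length_Suc_conv)

lemma snoc_in_paths_iff:
  assumes "1 \<le> b" and "b \<le> p' - 1"
  shows "s @ [c] \<in> paths p' a b (Suc m) \<longleftrightarrow>
    c = b \<and> s \<in> paths p' a (s ! m) m \<and> s ! m \<in> {b - 2, b, b + 2} \<and> allowed p' (s ! m) b"
proof (cases "length s = Suc m")
  case True
  then show ?thesis
    using assms
    by (auto simp: paths_def allowed_def nth_append All_less_Suc less_Suc_eq_le[symmetric] simp del: upt_Suc)
next
  case False
  then show ?thesis
    by (auto simp: paths_def)
qed

text \<open>Only the index \<open>m\<close> becomes interior; for \<open>m = 0\<close> its factor
  \<open>m\<close> removes the meaningless weight.\<close>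

lemma energy_snoc:
  assumes "length s = Suc m"
  shows "energy t p' (Suc m) (s @ [b]) =
    energy t p' m s + of_nat m * weight t p' (s ! (m - 1)) (s ! m) b"
proof (cases m)
  case 0
  then show ?thesis
    by (simp add: energy_def)
next
  case (Suc k)
  have "energy t p' (Suc m) (s @ [b]) =
    (\<Sum>i\<in>{1..<m}. of_nat i * weight t p' ((s @ [b]) ! (i - 1)) ((s @ [b]) ! i) ((s @ [b]) ! (i + 1)))
      + of_nat m * weight t p' ((s @ [b]) ! (m - 1)) ((s @ [b]) ! m) ((s @ [b]) ! (m + 1))"
    unfolding energy_def using Suc by simp
  also have "(\<Sum>i\<in>{1..<m}. of_nat i * weight t p' ((s @ [b]) ! (i - 1)) ((s @ [b]) ! i) ((s @ [b]) ! (i + 1)))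
      = energy t p' m s"
    unfolding energy_def using assms by (intro sum.cong) (auto simp: nth_append)
  finally show ?thesis
    using assms Suc by (simp add: nth_append)
qed

lemma sum_paths_Suc:
  assumes "1 \<le> b" and "b \<le> p' - 1"
  shows "(\<Sum>s\<in>paths p' a b (Suc m). f s) =
    (\<Sum>d\<in>{b + 2, b, b - 2}. if allowed p' d b then \<Sum>s\<in>paths p' a d m. f (s @ [b]) else 0)"
proof -
  let ?D = "{d \<in> {b + 2, b, b - 2}. allowed p' d b}"
  have last: "s ! m = d" and len: "length s = Suc m" if "s \<in> paths p' a d m" for s d
    using that by (simp_all add: paths_def)
  have "(\<Sum>s\<in>paths p' a b (Suc m). f s) = (\<Sum>x\<in>Sigma ?D (\<lambda>d. paths p' a d m). f (snd x @ [b]))"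
  proof (rule sum.reindex_bij_witness[of _ "\<lambda>x. snd x @ [b]" "\<lambda>s. (s ! m, butlast s)"])
    fix s assume s: "s \<in> paths p' a b (Suc m)"
    then have "s \<noteq> []" "length s = Suc (Suc m)" "s ! Suc m = b" by (auto simp: paths_def)
    then have "last s = b" by (simp add: last_conv_nth)
    then have snoc: "butlast s @ [b] = s"
      using \<open>s \<noteq> []\<close> append_butlast_last_id by fastforce
    have nth: "butlast s ! m = s ! m"
      using \<open>length s = Suc (Suc m)\<close> by (simp add: nth_butlast)
    from s have "butlast s @ [b] \<in> paths p' a b (Suc m)" unfolding snoc .
    then show "(s ! m, butlast s) \<in> Sigma ?D (\<lambda>d. paths p' a d m)"
      unfolding snoc_in_paths_iff[OF assms] nth by auto
    show "snd (s ! m, butlast s) @ [b] = s" "f (snd (s ! m, butlast s) @ [b]) = f s"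
      using snoc by simp_all
  next
    fix x assume "x \<in> Sigma ?D (\<lambda>d. paths p' a d m)"
    then obtain d s where x: "x = (d, s)" "d \<in> ?D" "s \<in> paths p' a d m" by auto
    show "snd x @ [b] \<in> paths p' a b (Suc m)"
      unfolding x(1) snd_conv snoc_in_paths_iff[OF assms] using x(2,3) last[OF x(3)] by auto
    show "((snd x @ [b]) ! m, butlast (snd x @ [b])) = x"
      using last[OF x(3)] len[OF x(3)] by (simp add: x(1) nth_append)
  qed
  also have "\<dots> = (\<Sum>d\<in>?D. \<Sum>s\<in>paths p' a d m. f (s @ [b]))"
    by (subst sum.Sigma) (auto simp: finite_paths split_beta)
  also have "\<dots> = (\<Sum>d\<in>{b + 2, b, b - 2}. if allowed p' d b then \<Sum>s\<in>paths p' a d m. f (s @ [b]) else 0)"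
    by (subst sum.inter_filter) simp_all
  finally show ?thesis .
qed

text \<open>For \<open>m = 0\<close> natural subtraction makes \<open>s ! (m - 1)\<close> the entry
  \<open>d\<close> itself; that case is kept apart and always carries the factor \<open>m\<close>
  where the lemma is used.\<close>

lemma penultimate_cases:
  assumes "s \<in> paths p' a d m"
  shows "m = 0 \<or> (s ! (m - 1) \<in> {d - 2, d, d + 2} \<and> allowed p' (s ! (m - 1)) d)"
proof (cases m)
  case (Suc k)
  then have "s ! k - s ! Suc k \<in> {0, 2, -2}" "(s ! k, s ! Suc k) \<noteq> (1, 1)" "(s ! k, s ! Suc k) \<noteq> (p' - 1, p' - 1)"
    "1 \<le> s ! k" "s ! k \<le> p' - 1" "s ! Suc k = d"
    using assms by (auto simp: paths_def)
  then show ?thesis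
    using Suc by (auto simp: allowed_def)
qed simp

text \<open>
  Subtracting the second difference of \<open>s\<^sup>2/(4t)\<close> from the weights makes them all integers, and
  changes the energy of a path only through its first and its last two entries.
\<close>

definition gauge :: "rat \<Rightarrow> int \<Rightarrow> rat" where
  "gauge t s = of_int (s\<^sup>2) / (4 * t)"

text \<open>The weight of a last step from \<open>u\<close> to \<open>b\<close>; the final branch
  stands for \<open>u = b - 2\<close>.\<close>

definition end_weight :: "int \<Rightarrow> int \<Rightarrow> int \<Rightarrow> int \<Rightarrow> int" where
  "end_weight \<alpha> \<beta> b u = (if u = b + 2 then - \<alpha> else if u = b then 1 else \<beta>)"

definition path_sum :: "rat \<Rightarrow> int \<Rightarrow> int \<Rightarrow> nat \<Rightarrow> int \<Rightarrow> int \<Rightarrow> int \<Rightarrow> qfield" where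
  "path_sum t p' a m \<alpha> \<beta> b = (\<Sum>s\<in>paths p' a b m.
     qpow (energy t p' m s
       + of_nat m * (gauge t (s ! (m - 1)) - gauge t b + of_int (end_weight \<alpha> \<beta> b (s ! (m - 1))))
       + gauge t b - gauge t a))"

lemma path_sum_0:
  assumes "1 \<le> a" "a \<le> p' - 1"
  shows "path_sum t p' a 0 \<alpha> \<beta> b = (if a = b then 1 else 0)"
  using assms by (auto simp: path_sum_def paths_0 energy_def qpow_0)

text \<open>The second difference telescopes with the \<open>gauge\<close> terms at the end of the
  path: those in \<open>b\<close> cancel, and what is left are the end terms of the path without its
  last entry.\<close>

lemma path_sum_inner:
  assumes "\<And>u. u \<in> {d - 2, d, d + 2} \<Longrightarrow> allowed p' u d \<Longrightarrow> weight t p' u d b =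
      gauge t u - 2 * gauge t d + gauge t b + of_int (c + end_weight \<alpha>' \<beta>' d u)"
  shows "(\<Sum>s\<in>paths p' a d m. qpow (energy t p' (Suc m) (s @ [b])
       + of_nat (Suc m) * (gauge t ((s @ [b]) ! (Suc m - 1)) - gauge t b
           + of_int (end_weight \<alpha> \<beta> b ((s @ [b]) ! (Suc m - 1))))
       + gauge t b - gauge t a)) =
    qz ((int m + 1) * end_weight \<alpha> \<beta> b d + int m * c) * path_sum t p' a m \<alpha>' \<beta>' d"
  unfolding path_sum_def sum_distrib_left
proof (rule sum.cong)
  fix s assume s: "s \<in> paths p' a d m"
  then have len: "length s = Suc m" and d: "s ! m = d" by (simp_all add: paths_def)
  have w: "of_nat m * weight t p' (s ! (m - 1)) d b = of_nat m * (gauge t (s ! (m - 1)) - 2 * gauge t d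
      + gauge t b + of_int (c + end_weight \<alpha>' \<beta>' d (s ! (m - 1))))"
    using penultimate_cases[OF s] assms by auto
  have nth: "(s @ [b]) ! (Suc m - 1) = d"
    using len d by (simp add: nth_append)
  show "qpow (energy t p' (Suc m) (s @ [b])
       + of_nat (Suc m) * (gauge t ((s @ [b]) ! (Suc m - 1)) - gauge t b
           + of_int (end_weight \<alpha> \<beta> b ((s @ [b]) ! (Suc m - 1))))
       + gauge t b - gauge t a) =
    qz ((int m + 1) * end_weight \<alpha> \<beta> b d + int m * c) * qpow (energy t p' m s
       + of_nat m * (gauge t (s ! (m - 1)) - gauge t d + of_int (end_weight \<alpha>' \<beta>' d (s ! (m - 1))))
       + gauge t d - gauge t a)"
    unfolding nth energy_snoc[OF len] d w qpow_add[symmetric]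
    by (intro arg_cong[of _ _ qpow]) (simp add: algebra_simps)
qed simp

text \<open>\<open>Delta\<close> is \<open>gauge\<close> plus an affine function of \<open>s\<close>
  that changes by \<open>r\<close> up to sign over a step of size 2. This is why the last step gets
  both weights equal to \<open>r\<close>.\<close>

lemma Delta_eq_gauge:
  assumes "t \<noteq> 0"
  shows "Delta t r s = gauge t s - of_int (r * s) / 2 + (of_int (r\<^sup>2) * t\<^sup>2 - (t - 1)\<^sup>2) / (4 * t)"
  using assms by (simp add: Delta_def gauge_def field_simps power2_eq_square)

section \<open>The path recursion and the alternating sums\<close>

text \<open>
  \<open>N s\<close> stands for the integer part of \<open>(s + 1)/t\<close>.  At \<open>s = p' - 1\<close> the true values \<open>p\<close> and
  \<open>Two\<close> are replaced by \<open>p - 1\<close> and \<open>OneB\<close>, which makes the right end of the strip the mirror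
  image of the left end; no weight of a path depends on this.
\<close>

locale sites =
  fixes p p' :: int and N :: "int \<Rightarrow> int" and kind :: "int \<Rightarrow> site_type"
  assumes p': "4 \<le> p'"
    and N_left: "N (-1) = 0" "N 0 = 0"
    and N_right: "N (p' - 2) = p - 1" "N (p' - 1) = p - 1"
    and kind_left: "kind 1 = OneA" "kind 2 \<noteq> OneA"
    and kind_right: "kind (p' - 1) = OneB" "kind (p' - 2) \<noteq> OneB"
    and N_step: "1 \<le> s \<Longrightarrow> s \<le> p' - 1 \<Longrightarrow> N s = N (s - 2) + (if kind s = Two then 2 else 1)"
    and no_BA: "1 \<le> s \<Longrightarrow> s + 2 \<le> p' - 1 \<Longrightarrow> kind s = OneB \<Longrightarrow> kind (s + 2) \<noteq> OneA"
begin

text \<open>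
  The first three cases come from edges leaving \<open>b\<close> in generic position and from the minimal
  labels; the last two come from edges to a neighbour of type \<open>1\<^sub>A\<close> above or \<open>1\<^sub>B\<close> below.
\<close>

definition admissible :: "int \<Rightarrow> int \<Rightarrow> int \<Rightarrow> bool" where
  "admissible b \<alpha> \<beta> \<longleftrightarrow>
     \<alpha> = N b \<and> \<beta> = N b
   \<or> \<alpha> = N (b - 2) + 1 \<and> \<beta> = N (b - 2) + 1
   \<or> kind b = Two \<and> \<alpha> = N b - 1 \<and> \<beta> = N b
   \<or> b + 2 \<le> p' - 1 \<and> kind (b + 2) = OneA \<and> \<alpha> = N b - 1 \<and> \<beta> = N b
   \<or> 1 \<le> b - 2 \<and> kind (b - 2) = OneB \<and> \<alpha> = N (b - 2) + 1 \<and> \<beta> = N (b - 2) + 2"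

text \<open>\<open>kind b\<close> fixes \<open>N b - N (b - 2)\<close>, after which the admissible
  pairs are those of the three q-trinomial recursions; \<open>no_BA\<close> excludes the one
  remaining pair at sites of type \<open>OneA\<close> and \<open>OneB\<close>.\<close>

lemma altsum_rec:
  assumes "0 \<le> m" and "1 \<le> b" "b \<le> p' - 1" and "admissible b \<alpha> \<beta>"
  shows "altsum K p p' a (m + 1) \<alpha> \<beta> b =
    qz (m * (N b + 1) - (m + 1) * \<alpha>)
      * altsum K p p' a m (N b + 1) (N b + 1 + (if kind b = OneB then 1 else 0)) (b + 2)
    + qz (m + 1 + (if kind b = Two then 0 else m))
      * altsum K p p' a m (N b - (if kind b = Two then 1 else 0)) (N b) b
    + qz ((m + 1) * \<beta> - m * N (b - 2))
      * altsum K p p' a m (N (b - 2) - (if kind b = OneA then 1 else 0)) (N (b - 2)) (b - 2)"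
proof (rule altsum_step)
  fix l
  have m2: "2 * m + 1 = m + 1 + m" by simp
  show "trinom (m + 1) \<alpha> \<beta> l =
    qz (m * (N b + 1) - (m + 1) * \<alpha>)
      * trinom m (N b + 1) (N b + 1 + (if kind b = OneB then 1 else 0)) (l - 1)
    + qz (m + 1 + (if kind b = Two then 0 else m))
      * trinom m (N b - (if kind b = Two then 1 else 0)) (N b) l
    + qz ((m + 1) * \<beta> - m * N (b - 2))
      * trinom m (N (b - 2) - (if kind b = OneA then 1 else 0)) (N (b - 2)) (l + 1)"
  proof (cases "kind b")
    case Two
    then have n: "N (b - 2) = N b - 2" using N_step[OF assms(2,3)] by simp
    have "(\<alpha>, \<beta>) \<in> {(N b - 1, N b), (N b - 1, N b - 1), (N b, N b)}"
      using assms(4) Two unfolding admissible_def n by auto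
    from trinom_step_Two[OF assms(1) this, of l] show ?thesis
      unfolding n Two by simp
  next
    case OneA
    then have n: "N (b - 2) = N b - 1" using N_step[OF assms(2,3)] by simp
    have "\<not> (1 \<le> b - 2 \<and> kind (b - 2) = OneB)"
      using no_BA[of "b - 2"] OneA assms(3) by auto
    then have \<beta>: "\<beta> = N b" and \<alpha>: "\<alpha> = N b \<or> \<alpha> = N b - 1"
      using assms(4) OneA unfolding admissible_def n by auto
    from trinom_step_A[OF assms(1) \<alpha>, of l] show ?thesis
      unfolding n OneA \<beta> m2 by simp
  next
    case OneB
    then have n: "N (b - 2) = N b - 1" using N_step[OF assms(2,3)] by simp
    have "\<not> (b + 2 \<le> p' - 1 \<and> kind (b + 2) = OneA)"
      using no_BA[of b] OneB assms(2) by auto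
    then have \<alpha>: "\<alpha> = N b" and \<beta>: "\<beta> = N b \<or> \<beta> = N b + 1"
      using assms(4) OneB unfolding admissible_def n by auto
    from trinom_step_B[OF assms(1) \<beta>, of l] show ?thesis
      unfolding n OneB \<alpha> m2 by (simp add: add.assoc)
  qed
qed

text \<open>\<open>Q\<close> stands for the path sum, of which only the initial values and the
  recursion enter. Steps excluded by \<open>allowed\<close> are absent from that recursion, so their
  terms in the alternating sum have to vanish or cancel at the walls.\<close>

lemma path_recursion_eq_altsum:
  fixes Q :: "nat \<Rightarrow> int \<Rightarrow> int \<Rightarrow> int \<Rightarrow> qfield"
  assumes a: "1 \<le> a" "a \<le> p' - 1"
    and Q_0: "\<And>\<alpha> \<beta> b. Q 0 \<alpha> \<beta> b = (if a = b then 1 else 0)"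
    and Q_Suc: "\<And>m \<alpha> \<beta> b. 1 \<le> b \<Longrightarrow> b \<le> p' - 1 \<Longrightarrow> Q (Suc m) \<alpha> \<beta> b =
      (if allowed p' (b + 2) b then
        qz (int m * (N b + 1) - (int m + 1) * \<alpha>)
          * Q m (N b + 1) (N b + 1 + (if kind b = OneB then 1 else 0)) (b + 2) else 0)
      + (if allowed p' b b then
        qz (int m + 1 + (if kind b = Two then 0 else int m))
          * Q m (N b - (if kind b = Two then 1 else 0)) (N b) b else 0)
      + (if allowed p' (b - 2) b then
        qz ((int m + 1) * \<beta> - int m * N (b - 2))
          * Q m (N (b - 2) - (if kind b = OneA then 1 else 0)) (N (b - 2)) (b - 2) else 0)"
    and K: "int m + \<bar>a\<bar> + p' + 1 < K"
    and b: "1 \<le> b" "b \<le> p' - 1" "even (a - b)" and "admissible b \<alpha> \<beta>"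
  shows "Q m \<alpha> \<beta> b = altsum K p p' a (int m) \<alpha> \<beta> b"
  using K b \<open>admissible b \<alpha> \<beta>\<close>
proof (induction m arbitrary: \<alpha> \<beta> b)
  case 0
  then show ?case
    using altsum_0[of K a p' b p \<alpha> \<beta>] a p' by (simp add: Q_0)
next
  case (Suc m)
  note K = Suc.prems(1) and b = Suc.prems(2-4) and adm = Suc.prems(5)
  have IH: "Q m \<alpha>' \<beta>' d = altsum K p p' a (int m) \<alpha>' \<beta>' d"
    if "1 \<le> d" "d \<le> p' - 1" "even (a - d)" "admissible d \<alpha>' \<beta>'" for \<alpha>' \<beta>' d
    using Suc.IH[of d \<alpha>' \<beta>'] that K by simp
  let ?Z = "altsum K p p' a (int m)"
  define t1 where "t1 = qz (int m * (N b + 1) - (int m + 1) * \<alpha>)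
          * ?Z (N b + 1) (N b + 1 + (if kind b = OneB then 1 else 0)) (b + 2)"
  define t2 where "t2 = qz (int m + 1 + (if kind b = Two then 0 else int m))
          * ?Z (N b - (if kind b = Two then 1 else 0)) (N b) b"
  define t3 where "t3 = qz ((int m + 1) * \<beta> - int m * N (b - 2))
          * ?Z (N (b - 2) - (if kind b = OneA then 1 else 0)) (N (b - 2)) (b - 2)"
  have Z: "altsum K p p' a (int (Suc m)) \<alpha> \<beta> b = t1 + t2 + t3"
    using altsum_rec[of "int m" b \<alpha> \<beta> K a] b adm by (simp add: t1_def t2_def t3_def add.commute)
  \<comment> \<open>The induction closes because the weights attached to each of the three
    predecessors of \<open>b\<close> are admissible there.\<close>
  have 1: "allowed p' (b + 2) b \<Longrightarrow>
      qz (int m * (N b + 1) - (int m + 1) * \<alpha>)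
          * Q m (N b + 1) (N b + 1 + (if kind b = OneB then 1 else 0)) (b + 2) = t1"
    unfolding t1_def using b by (subst IH) (auto simp: allowed_def admissible_def)
  have 2: "allowed p' b b \<Longrightarrow>
      qz (int m + 1 + (if kind b = Two then 0 else int m))
          * Q m (N b - (if kind b = Two then 1 else 0)) (N b) b = t2"
    unfolding t2_def using b by (subst IH) (auto simp: allowed_def admissible_def)
  have 3: "allowed p' (b - 2) b \<Longrightarrow>
      qz ((int m + 1) * \<beta> - int m * N (b - 2))
          * Q m (N (b - 2) - (if kind b = OneA then 1 else 0)) (N (b - 2)) (b - 2) = t3"
    unfolding t3_def using b by (subst IH) (auto simp: allowed_def admissible_def)
  have Q: "Q (Suc m) \<alpha> \<beta> b = (if allowed p' (b + 2) b then t1 else 0)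
      + (if allowed p' b b then t2 else 0) + (if allowed p' (b - 2) b then t3 else 0)"
    using Q_Suc[OF b(1,2), of m \<alpha> \<beta>] 1 2 3 by (simp cong: if_cong)
  \<comment> \<open>The only excluded predecessor here is the wall \<open>p'\<close>, where the
    alternating sum with both weights \<open>p\<close> is zero.\<close>
  have Q1: "(if allowed p' (b + 2) b then t1 else 0) = t1" if "b \<noteq> p' - 1"
  proof (cases "b = p' - 2")
    case True
    then have "t1 = 0"
      using altsum_end[of "int m" a p' K p] kind_right N_right K b p' by (simp add: t1_def)
    then show ?thesis by simp
  qed (use that b in \<open>auto simp: allowed_def\<close>)
  have Q3: "(if allowed p' (b - 2) b then t3 else 0) = t3" if "b \<noteq> 1"
  proof (cases "b = 2")
    case True
    then have "t3 = 0"
      using altsum_origin[of K p p' a "int m"] kind_left N_left by (simp add: t3_def)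
    then show ?thesis by simp
  qed (use that b in \<open>auto simp: allowed_def\<close>)
  consider "b = 1" | "b = p' - 1" | "b \<noteq> 1" "b \<noteq> p' - 1" by blast
  then show ?case
  proof cases
    case 1
    have N: "N 1 = 1"
      using N_step[of 1] kind_left N_left p' by simp
    then have "\<beta> = 1"
      using adm 1 kind_left N_left by (auto simp: admissible_def)
    \<comment> \<open>The missing level step 1 -> 1 and the missing step -1 -> 1 cancel.\<close>
    have "t2 + t3 = 0"
      using altsum_left_boundary[of K p p' a m] altsum_reflect[of K p p' a "int m" 1 0 1]
        N N_left kind_left \<open>\<beta> = 1\<close>
      by (simp add: t2_def t3_def 1 mult.assoc[symmetric] flip: qpow_add)
    then show ?thesis
      unfolding Q Z using Q1 1 p' by (simp add: allowed_def add.assoc)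
  next
    case 2
    have n: "N (b - 2) + 1 = p - 1"
      using N_step[of "p' - 1"] kind_right N_right p' 2 by simp
    have \<alpha>: "\<alpha> = p - 1"
      using adm n 2 kind_right N_right by (auto simp: admissible_def)
    \<comment> \<open>Likewise for the missing steps to \<open>p' - 1\<close> from
      \<open>p' + 1\<close> and from \<open>p' - 1\<close> itself.\<close>
    have "t1 + t2 = 0"
    proof -
      have e: "p' - 1 + 2 = p' + 1" "p - 1 + 1 = p"
        by simp_all
      have "?Z p (p + 1) (p' + 1) = - (qz p * (qz (int m) * ?Z (p - 1) (p - 1) (p' - 1)))"
        using altsum_end_reflect[of "int m" a p' K p] altsum_right_boundary[of m a p' K p] K b 2 p'
        by simp
      moreover have "int m * p - (int m + 1) * (p - 1) + p + int m = int m + 1 + int m"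
        by (simp add: algebra_simps)
      then have "qz (int m * p - (int m + 1) * (p - 1)) * qz p * qz (int m) = qz (int m + 1 + int m)"
        unfolding qz_add[symmetric] by (simp only:)
      moreover have "t1 = qz (int m * p - (int m + 1) * (p - 1)) * ?Z p (p + 1) (p' + 1)"
        "t2 = qz (int m + 1 + int m) * ?Z (p - 1) (p - 1) (p' - 1)"
        unfolding t1_def t2_def 2 \<alpha> N_right kind_right e by simp_all
      ultimately show ?thesis
        by (simp only: mult.assoc[symmetric] mult_minus_right mult_minus_left add.left_inverse)
    qed
    then show ?thesis
      unfolding Q Z using Q3 2 p' by (simp add: allowed_def)
  next
    case 3
    then have "allowed p' b b" using b by (simp add: allowed_def)
    then show ?thesis
      unfolding Q Z using Q1 Q3 3 by simp
  qed
qed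

end

section \<open>The labels and types of the sites\<close>

locale coprime_pair =
  fixes p p' :: int and t :: rat
  assumes p: "3 \<le> p" and pp': "p < p'" "p' < 2 * p" and coprime: "coprime p p'"
    and t: "t = of_int p' / of_int p"
begin

definition fl :: "int \<Rightarrow> int" where
  "fl s = \<lfloor>of_int (s + 1) / t\<rfloor>"

lemma t_pos: "t > 0"
  using p pp' by (simp add: t)

lemma fl_eq_iff: "fl s = k \<longleftrightarrow> k * p' \<le> (s + 1) * p \<and> (s + 1) * p < k * p' + p'"
proof -
  have "of_int (s + 1) / t = of_int ((s + 1) * p) / of_int p'"
    by (simp add: t)
  then have "fl s = (s + 1) * p div p'"
    unfolding fl_def by (simp only: floor_divide_of_int_eq)
  moreover have "x div p' = k \<longleftrightarrow> k * p' \<le> x \<and> x < k * p' + p'" for x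
  proof
    assume "x div p' = k"
    then have "x = k * p' + x mod p'"
      using div_mult_mod_eq[of x p'] by simp
    then show "k * p' \<le> x \<and> x < k * p' + p'"
      using pos_mod_sign[of p' x] pos_mod_bound[of p' x] p pp' by linarith
  next
    assume "k * p' \<le> x \<and> x < k * p' + p'"
    then show "x div p' = k"
      by (intro int_div_pos_eq[of _ _ _ "x - k * p'"]) (simp_all add: algebra_simps)
  qed
  ultimately show ?thesis by simp
qed

lemma fl_bounds: "fl s * p' \<le> (s + 1) * p" "(s + 1) * p < fl s * p' + p'"
  using fl_eq_iff[of s "fl s"] by simp_all

lemma fl_cases: "fl s = fl (s - 1) \<or> fl s = fl (s - 1) + 1"
proof (rule disjCI)
  assume *: "fl s \<noteq> fl (s - 1) + 1"
  show "fl s = fl (s - 1)"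
    using fl_bounds[of "s - 1"] * pp' p unfolding fl_eq_iff by (simp add: algebra_simps)
qed

lemma tau_eq: "tau t s = fl s - fl (s - 2)"
  by (simp add: tau_def fl_def)

lemma fl_step: "fl s = fl (s - 2) + 1 \<or> fl s = fl (s - 2) + 2"
proof (rule disjCI)
  assume *: "fl s \<noteq> fl (s - 2) + 2"
  show "fl s = fl (s - 2) + 1"
    using fl_bounds[of "s - 2"] * pp' p unfolding fl_eq_iff by (simp add: algebra_simps)
qed

lemma fl_values:
  "fl (-1) = 0" "fl 0 = 0" "fl 1 = 1" "fl (p' - 2) = p - 1" "fl (p' - 3) = p - 2" "fl (p' - 1) = p"
  using p pp' unfolding fl_eq_iff by (simp_all add: algebra_simps)

text \<open>The increments of \<open>fl\<close> between neighbouring sites are 0 or 1, and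
  \<open>tau\<close> is the sum of two consecutive ones. Hence at a site with \<open>tau\<close>
  equal to 1 the alternation only records whether the increment arriving there is 0
  (\<open>OneB\<close>) or 1 (\<open>OneA\<close>).\<close>

lemma alternating_type_eq:
  "alternating_type t n =
    (if tau t (int n) = 2 then Two else if fl (int n) = fl (int n - 1) then OneB else OneA)"
proof (induction n)
  case 0
  have "fl (-2) = -1"
    using p pp' unfolding fl_eq_iff by (simp add: algebra_simps)
  then show ?case
    by (simp add: tau_eq fl_values)
next
  case (Suc n)
  then show ?case
    using fl_cases[of "int n"] fl_cases[of "int n - 1"] fl_cases[of "int n + 1"]
      fl_step[of "int n"] fl_step[of "int n + 1"]
    by (auto simp: tau_eq algebra_simps)
qed

section \<open>Verification of the site axioms\<close>

definition lev :: "int \<Rightarrow> int" where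
  "lev s = (if s = p' - 1 then p - 1 else fl s)"

definition kind :: "int \<Rightarrow> site_type" where
  "kind s = (if s = p' - 1 then OneB else type_of_site t p' s)"

lemma t_iffs: "t \<le> 5 / 3 \<longleftrightarrow> 3 * p' \<le> 5 * p" "3 / 2 < t \<longleftrightarrow> 3 * p < 2 * p'"
proof -
  have "t \<le> 5 / 3 \<longleftrightarrow> (of_int (3 * p') :: rat) \<le> of_int (5 * p)"
    "3 / 2 < t \<longleftrightarrow> (of_int (3 * p) :: rat) < of_int (2 * p')"
    using p by (simp_all add: t field_simps)
  then show "t \<le> 5 / 3 \<longleftrightarrow> 3 * p' \<le> 5 * p" "3 / 2 < t \<longleftrightarrow> 3 * p < 2 * p'"
    by (simp_all only: of_int_le_iff of_int_less_iff)
qed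

lemma not_3_2: "3 * p \<noteq> 2 * p'"
proof
  assume *: "3 * p = 2 * p'"
  then have "p dvd 2 * p'" by (metis dvd_triv_right)
  then have "p dvd 2" using coprime by (simp add: coprime_dvd_mult_left_iff)
  then show False using zdvd_imp_le[of p 2] p by simp
qed

lemma type_of_site_Two: "type_of_site t p' s = Two \<longleftrightarrow> tau t s = 2" if "0 \<le> s"
  using that by (auto simp: type_of_site_def alternating_type_eq)

lemma type_of_site_large:
  assumes "5 * p < 3 * p'" and "0 \<le> s" and "tau t s \<noteq> 2"
  shows "type_of_site t p' s = (if fl s = fl (s - 1) then OneB else OneA)"
  using assms t_iffs by (simp add: type_of_site_def alternating_type_eq)

lemma sites: "sites p p' lev kind"
proof
  show "4 \<le> p'" using p pp' by simp
  show "lev (-1) = 0" "lev 0 = 0" "lev (p' - 2) = p - 1" "lev (p' - 1) = p - 1"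
    using p pp' fl_values by (simp_all add: lev_def)
  show "kind (p' - 1) = OneB" by (simp add: kind_def)
  have "tau t 1 \<noteq> 2" and "alternating_type t 1 = OneA"
    using alternating_type_eq[of 1] by (simp_all add: tau_eq fl_values(1-3))
  then show kind_1: "kind 1 = OneA"
    using p pp' by (auto simp: kind_def type_of_site_def)
  show "kind 2 \<noteq> OneA"
  proof (cases "3 / 2 < t")
    case True
    then have "3 * p < 2 * p'"
      using t_iffs(2) by blast
    then have "fl 2 = 1"
      using p pp' unfolding fl_eq_iff by simp
    then have "alternating_type t 2 \<noteq> OneA"
      using alternating_type_eq[of 2] by (simp add: fl_values(3))
    then show ?thesis
      using True by (auto simp: kind_def type_of_site_def)
  next
    case False
    then have "fl 2 = 2"
      using p pp' t_iffs(2) unfolding fl_eq_iff by simp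
    then have "tau t 2 = 2"
      by (simp add: tau_eq fl_values(2))
    then show ?thesis
      by (simp add: kind_def type_of_site_def)
  qed
  show "kind (p' - 2) \<noteq> OneB"
  proof (cases "3 / 2 < t")
    case True
    \<comment> \<open>The exception for \<open>s = 2\<close> comes first in
      \<open>type_of_site\<close>, so \<open>p' - 2 = 2\<close> has to be ruled out.\<close>
    then have "p' \<noteq> 4"
      using p t_iffs(2) by auto
    moreover have "alternating_type t (nat (p' - 2)) \<noteq> OneB"
      using alternating_type_eq[of "nat (p' - 2)"] p pp'
      by (auto simp: fl_values(4-5)[simplified] diff_diff_eq)
    ultimately show ?thesis
      using True by (auto simp: kind_def type_of_site_def)
  next
    case False
    then have "fl (p' - 4) = p - 3"
      using p pp' not_3_2 t_iffs(2) unfolding fl_eq_iff by (simp add: algebra_simps)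
    then have "tau t (p' - 2) = 2"
      by (simp add: tau_eq fl_values(4))
    then show ?thesis
      by (simp add: kind_def type_of_site_def)
  qed
  show "lev s = lev (s - 2) + (if kind s = Two then 2 else 1)" if "1 \<le> s" "s \<le> p' - 1" for s
    using that fl_values fl_step[of s] type_of_site_Two[of s]
    by (auto simp: lev_def kind_def tau_eq)
  show "kind (s + 2) \<noteq> OneA" if s: "1 \<le> s" "s + 2 \<le> p' - 1" and B: "kind s = OneB" for s
  proof
    assume A: "kind (s + 2) = OneA"
    then have s': "s + 2 \<noteq> p' - 1" by (auto simp: kind_def)
    then have A: "type_of_site t p' (s + 2) = OneA" and B: "type_of_site t p' s = OneB"
      using A B s by (simp_all add: kind_def)
    then have tau: "tau t s \<noteq> 2" "tau t (s + 2) \<noteq> 2"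
      using type_of_site_Two[of s] type_of_site_Two[of "s + 2"] s by auto
    show False
    proof (cases "t \<le> 5 / 3")
      \<comment> \<open>Type \<open>OneB\<close> at \<open>s\<close> and \<open>OneA\<close> at
        \<open>s + 2\<close> would make the increments of \<open>fl\<close> at \<open>s\<close> and
        at \<open>s + 1\<close> both 0, against \<open>fl_step\<close>.\<close>
      case False
      have e: "s + 2 - 1 = s + 1"
        by simp
      from False have "5 * p < 3 * p'"
        using t_iffs(1) by simp
      then have "fl s = fl (s - 1)" "fl (s + 2) \<noteq> fl (s + 1)"
        using type_of_site_large[of s] type_of_site_large[of "s + 2", unfolded e] A B tau s
        by (auto split: if_splits)
      then show False
        using fl_step[of "s + 1"] fl_step[of "s + 2"] fl_cases[of "s + 1"] tau
        by (auto simp: tau_eq)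
    next
      case True
      then have le: "3 * p' \<le> 5 * p"
        using t_iffs(1) by blast
      \<comment> \<open>With the types divided at half of \<open>p'\<close>, a \<open>OneB\<close>
        two below a \<open>OneA\<close> can only come from the exceptional sites; in both cases the
        other of the two sites turns out to have \<open>tau\<close> equal to 2.\<close>
      from True consider "s = 2" "3 / 2 < t" | "s + 2 = p' - 2" "3 / 2 < t" "s \<noteq> 2"
        using A B tau s by (auto simp: type_of_site_def split: if_splits)
      then show False
      proof cases
        case 1
        then have "3 * p < 2 * p'"
          using t_iffs(2) by blast
        then have "fl 2 = 1" "fl 4 = 3"
          using p pp' le unfolding fl_eq_iff by simp_all
        then show False
          using tau 1 by (simp add: tau_eq)
      next
        case 2
        then have "3 * p < 2 * p'"
          using t_iffs(2) by blast
        have s_eq: "s = p' - 4"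
          using 2 by simp
        have "s \<noteq> 1"
          using B kind_1 s' s by (auto simp: kind_def split: if_splits)
        \<comment> \<open>Equality would force \<open>p = 3\<close>, \<open>p' = 5\<close> and hence
          \<open>s = 1\<close>, a site of type \<open>OneA\<close>.\<close>
        have "5 * p \<noteq> 3 * p'"
        proof
          assume *: "5 * p = 3 * p'"
          then have "p dvd 3 * p'"
            by (metis dvd_triv_right)
          then have "p dvd 3"
            using coprime by (simp add: coprime_dvd_mult_left_iff)
          then have "p = 3"
            using zdvd_imp_le[of p 3] p by simp
          then show False
            using * s_eq \<open>s \<noteq> 1\<close> by simp
        qed
        then have "fl (p' - 6) = p - 4" "fl (p' - 4) = p - 2"
          using p pp' le \<open>3 * p < 2 * p'\<close> unfolding fl_eq_iff by (simp_all add: algebra_simps)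
        then show False
          using tau by (simp add: tau_eq s_eq)
      qed
    qed
  qed
qed

section \<open>Weights as second differences plus integers\<close>

lemma frac_eq:
  "frac ((of_int s + 1) / t) = (of_int s + 1) / t - of_int (fl s)"
  "frac ((1 + of_int s) / t) = (of_int s + 1) / t - of_int (fl s)"
  "frac ((of_int s - 1) / t) = (of_int s - 1) / t - of_int (fl (s - 2))"
  by (simp_all add: frac_def fl_def add.commute)

text \<open>The fractional parts are multiples of 1/t minus integers, so the second difference of
  \<open>gauge\<close> absorbs all terms in 1/t. The value 3 of \<open>xval\<close> at type
  \<open>OneB\<close> is what raises \<beta> by one.\<close>

lemma weight_down:
  assumes "1 \<le> b" and "b + 2 \<le> p' - 1" and "u \<in> {b, b + 2, b + 4}"
  shows "weight t p' u (b + 2) b = gauge t u - 2 * gauge t (b + 2) + gauge t b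
    + of_int (lev b + 1 + end_weight (lev b + 1) (lev b + 1 + (if kind b = OneB then 1 else 0)) (b + 2) u)"
  using assms t_pos
  by (auto simp: weight_def gauge_def end_weight_def frac_eq lev_def kind_def xval_def
      field_simps power2_eq_square split: site_type.split)

lemma weight_flat:
  assumes "1 \<le> b" and "b < p' - 1" and "u \<in> {b - 2, b, b + 2}"
  shows "weight t p' u b b = gauge t u - 2 * gauge t b + gauge t b
    + of_int ((if kind b = Two then 0 else 1) + end_weight (lev b - (if kind b = Two then 1 else 0)) (lev b) b u)"
proof -
  have n: "fl b = fl (b - 2) + (if type_of_site t p' b = Two then 2 else 1)"
    "tau t b = (if type_of_site t p' b = Two then 2 else 1)"
    using type_of_site_Two[of b] fl_step[of b] assms by (auto simp: tau_eq)
  show ?thesis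
    using assms t_pos n
    by (auto simp: weight_def gauge_def end_weight_def frac_eq lev_def kind_def
      field_simps power2_eq_square)
qed

text \<open>Once \<open>fl b\<close> is expressed through \<open>fl (b - 2)\<close>, the values of
  \<open>yval\<close> at types \<open>Two\<close> and \<open>OneB\<close> give the same integer;
  only type \<open>OneA\<close> lowers \<alpha> by one.\<close>

lemma weight_up:
  assumes "1 \<le> b - 2" and "b \<le> p' - 1" and "u \<in> {b - 4, b - 2, b}"
  shows "weight t p' u (b - 2) b = gauge t u - 2 * gauge t (b - 2) + gauge t b
    + of_int (- lev (b - 2) + end_weight (lev (b - 2) - (if kind b = OneA then 1 else 0)) (lev (b - 2)) (b - 2) u)"
proof -
  have n: "fl b = fl (b - 2) + (if type_of_site t p' b = Two then 2 else 1)"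
    using type_of_site_Two[of b] fl_step[of b] assms by (auto simp: tau_eq)
  \<comment> \<open>At \<open>p' - 1\<close> the true type is \<open>Two\<close> and
    \<open>kind\<close> is \<open>OneB\<close>; neither is \<open>OneA\<close>.\<close>
  have k: "kind b = OneA \<longleftrightarrow> type_of_site t p' b = OneA"
    using type_of_site_Two[of "p' - 1"] fl_values p pp' by (auto simp: kind_def tau_eq)
  show ?thesis
    using assms t_pos n
    by (auto simp: weight_def gauge_def end_weight_def frac_eq lev_def k yval_def
      field_simps power2_eq_square split: site_type.splits)
qed

lemma path_sum_Suc:
  assumes "1 \<le> b" and "b \<le> p' - 1"
  shows "path_sum t p' a (Suc m) \<alpha> \<beta> b =
      (if allowed p' (b + 2) b then
        qz (int m * (lev b + 1) - (int m + 1) * \<alpha>)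
          * path_sum t p' a m (lev b + 1) (lev b + 1 + (if kind b = OneB then 1 else 0)) (b + 2) else 0)
      + (if allowed p' b b then
        qz (int m + 1 + (if kind b = Two then 0 else int m))
          * path_sum t p' a m (lev b - (if kind b = Two then 1 else 0)) (lev b) b else 0)
      + (if allowed p' (b - 2) b then
        qz ((int m + 1) * \<beta> - int m * lev (b - 2))
          * path_sum t p' a m (lev (b - 2) - (if kind b = OneA then 1 else 0)) (lev (b - 2)) (b - 2) else 0)"
proof -
  define f where "f s = qpow (energy t p' (Suc m) s
       + of_nat (Suc m) * (gauge t (s ! (Suc m - 1)) - gauge t b
           + of_int (end_weight \<alpha> \<beta> b (s ! (Suc m - 1))))
       + gauge t b - gauge t a)" for s
  have 1: "(\<Sum>s\<in>paths p' a (b + 2) m. f (s @ [b])) = qz ((int m + 1) * end_weight \<alpha> \<beta> b (b + 2) + int m * (lev b + 1))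
      * path_sum t p' a m (lev b + 1) (lev b + 1 + (if kind b = OneB then 1 else 0)) (b + 2)"
    if "allowed p' (b + 2) b"
    unfolding f_def
  proof (rule path_sum_inner)
    fix u assume "u \<in> {b + 2 - 2, b + 2, b + 2 + 2}"
    then show "weight t p' u (b + 2) b = gauge t u - 2 * gauge t (b + 2) + gauge t b +
      of_int (lev b + 1 + end_weight (lev b + 1) (lev b + 1 + (if kind b = OneB then 1 else 0)) (b + 2) u)"
      using that assms by (intro weight_down) (auto simp: allowed_def)
  qed
  have 2: "(\<Sum>s\<in>paths p' a b m. f (s @ [b])) = qz ((int m + 1) * end_weight \<alpha> \<beta> b b + int m * (if kind b = Two then 0 else 1))
      * path_sum t p' a m (lev b - (if kind b = Two then 1 else 0)) (lev b) b"
    if "allowed p' b b"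
    unfolding f_def
  proof (rule path_sum_inner)
    fix u assume "u \<in> {b - 2, b, b + 2}"
    then show "weight t p' u b b = gauge t u - 2 * gauge t b + gauge t b +
      of_int ((if kind b = Two then 0 else 1) + end_weight (lev b - (if kind b = Two then 1 else 0)) (lev b) b u)"
      using that assms by (intro weight_flat) (auto simp: allowed_def)
  qed
  have 3: "(\<Sum>s\<in>paths p' a (b - 2) m. f (s @ [b])) = qz ((int m + 1) * end_weight \<alpha> \<beta> b (b - 2) + int m * (- lev (b - 2)))
      * path_sum t p' a m (lev (b - 2) - (if kind b = OneA then 1 else 0)) (lev (b - 2)) (b - 2)"
    if "allowed p' (b - 2) b"
    unfolding f_def
  proof (rule path_sum_inner)
    fix u assume "u \<in> {b - 2 - 2, b - 2, b - 2 + 2}"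
    then show "weight t p' u (b - 2) b = gauge t u - 2 * gauge t (b - 2) + gauge t b +
      of_int (- lev (b - 2) + end_weight (lev (b - 2) - (if kind b = OneA then 1 else 0)) (lev (b - 2)) (b - 2) u)"
      using that assms by (intro weight_up) (auto simp: allowed_def)
  qed
  have e: "(int m + 1) * end_weight \<alpha> \<beta> b (b + 2) + int m * (lev b + 1) = int m * (lev b + 1) - (int m + 1) * \<alpha>"
    "(int m + 1) * end_weight \<alpha> \<beta> b b + int m * (if kind b = Two then 0 else 1)
      = int m + 1 + (if kind b = Two then 0 else int m)"
    "(int m + 1) * end_weight \<alpha> \<beta> b (b - 2) + int m * (- lev (b - 2)) = (int m + 1) * \<beta> - int m * lev (b - 2)"
    by (simp_all add: end_weight_def)
  have "path_sum t p' a (Suc m) \<alpha> \<beta> b =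
      (\<Sum>d\<in>{b + 2, b, b - 2}. if allowed p' d b then \<Sum>s\<in>paths p' a d m. f (s @ [b]) else 0)"
    unfolding path_sum_def f_def[symmetric] by (rule sum_paths_Suc[OF assms])
  also have "\<dots> = (if allowed p' (b + 2) b then \<Sum>s\<in>paths p' a (b + 2) m. f (s @ [b]) else 0)
      + (if allowed p' b b then \<Sum>s\<in>paths p' a b m. f (s @ [b]) else 0)
      + (if allowed p' (b - 2) b then \<Sum>s\<in>paths p' a (b - 2) m. f (s @ [b]) else 0)"
    by (simp add: add.assoc)
  finally show ?thesis
    using 1 2 3 unfolding e by (simp cong: if_cong)
qed

lemma path_sum_eq_altsum:
  assumes "1 \<le> a" "a \<le> p' - 1" and "1 \<le> b" "b \<le> p' - 1" and "even (a - b)"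
    and "sites.admissible p' lev kind b \<alpha> \<beta>" and "int m + \<bar>a\<bar> + p' + 1 < K"
  shows "path_sum t p' a m \<alpha> \<beta> b = altsum K p p' a (int m) \<alpha> \<beta> b"
  using assms
  by (intro sites.path_recursion_eq_altsum[OF sites]) (simp_all only: path_sum_0 path_sum_Suc)

text \<open>Comparing \<open>b\<close> with \<open>b - 2\<close> and \<open>b + 2\<close> confines
  \<open>r\<close> to the interval from \<open>lev (b - 2) + 1\<close> to \<open>lev b\<close>. It
  has at most two elements, so \<open>r\<close> is one of its ends, and both ends are
  admissible.\<close>

lemma admissible_minimal_label:
  assumes r: "1 \<le> r" "r \<le> p - 1" and b: "1 \<le> b" "b \<le> p' - 1"
    and min: "\<And>s. 1 \<le> s \<Longrightarrow> s \<le> p' - 1 \<Longrightarrow> s mod 2 = b mod 2 \<Longrightarrow> Delta t r b \<le> Delta t r s"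
  shows "sites.admissible p' lev kind b r r"
proof -
  have diff: "Delta t r (b + 2) - Delta t r b = of_int (b + 1) / t - of_int r"
    "Delta t r (b - 2) - Delta t r b = of_int r - of_int (b - 1) / t"
    using t_pos by (simp_all add: Delta_def field_simps power2_eq_square)
  have hi: "r \<le> lev b"
  proof (cases "b + 2 \<le> p' - 1")
    case True
    then have "of_int r \<le> of_int (b + 1) / t"
      using min[of "b + 2"] b diff(1) by simp
    then have "r \<le> fl b"
      by (simp add: fl_def le_floor_iff)
    then show ?thesis
      using r by (simp add: lev_def)
  next
    case False
    then have "b = p' - 2 \<or> b = p' - 1"
      using b by auto
    then show ?thesis
      using r fl_values by (auto simp: lev_def)
  qed
  have lo: "lev (b - 2) + 1 \<le> r"
  proof (cases "1 \<le> b - 2")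
    case True
    then have "of_int (b - 1) / t \<le> of_int r"
      using min[of "b - 2"] b diff(2) by simp
    then have "(of_int ((b - 1) * p) :: rat) \<le> of_int (r * p')"
      using p pp' by (simp add: t field_simps)
    then have 1: "(b - 1) * p \<le> r * p'"
      by (simp only: of_int_le_iff)
    \<comment> \<open>Minimality gives only a weak inequality; equality is impossible because
      \<open>p\<close> does not divide \<open>r\<close>.\<close>
    have "fl (b - 2) < r"
    proof (rule ccontr)
      assume "\<not> fl (b - 2) < r"
      then have "r * p' \<le> fl (b - 2) * p'"
        using p pp' by (intro mult_right_mono) auto
      also have "\<dots> \<le> (b - 1) * p"
        using fl_bounds(1)[of "b - 2"] by simp
      finally have "r * p' = (b - 1) * p"
        using 1 by simp
      then have "p dvd r * p'"
        by simp
      then have "p dvd r"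
        using coprime by (simp add: coprime_dvd_mult_left_iff)
      then show False
        using r zdvd_imp_le[of p r] by simp
    qed
    then show ?thesis
      using True b by (simp add: lev_def)
  next
    case False
    then have "b = 1 \<or> b = 2"
      using b by auto
    then show ?thesis
      using r fl_values p pp' by (auto simp: lev_def)
  qed
  have "lev b = lev (b - 2) + 1 \<or> lev b = lev (b - 2) + 2"
    using sites.N_step[OF sites b] by auto
  then show ?thesis
    using hi lo unfolding sites.admissible_def[OF sites] by linarith
qed

end

theorem proposition2p3:
  fixes p p' r a b :: int and m :: nat and t :: rat
  assumes "3 \<le> p" and "p < p'" and "coprime p p'"
    and "t = of_int p' / of_int p" and "1 < t" and "t < 2"
    and "1 \<le> r" and "r \<le> p - 1"
    and "1 \<le> a" and "a \<le> p' - 1"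
    and "1 \<le> b" and "b \<le> p' - 1" and "b mod 2 = a mod 2"
    and "Delta t r b = Min {Delta t r s | s. 1 \<le> s \<and> s \<le> p' - 1 \<and> s mod 2 = a mod 2}"
  shows "I_sum p p' r a b m =
    (\<Sum>s\<in>paths p' a b m.
       qpow (energy t p' m s
             + of_nat m * (Delta t r (s ! (m - 1)) - Delta t r b
                           + (if s ! (m - 1) = b then 1 else 0))
             + Delta t r b - Delta t r a))"
proof -
  have "(of_int p' :: rat) < of_int (2 * p)"
    using assms(1,4) mult_strict_right_mono[OF assms(6), of "of_int p"] by simp
  then have "p' < 2 * p"
    by (simp only: of_int_less_iff)
  then interpret coprime_pair p p' t
    using assms by unfold_locales auto
  \<comment> \<open>Large enough both for the comparison with paths and for that with
    \<open>I_sum\<close>.\<close>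
  define K where "K = int m + a + b + p' + 2"
  have even: "even (a - b)"
    using assms(13) by presburger
  have min: "Delta t r b \<le> Delta t r s" if "1 \<le> s" "s \<le> p' - 1" "s mod 2 = b mod 2" for s
  proof -
    have "finite {Delta t r s | s. 1 \<le> s \<and> s \<le> p' - 1 \<and> s mod 2 = a mod 2}"
      by (rule finite_surj[of "{1..p' - 1}" _ "Delta t r"]) auto
    then show ?thesis
      unfolding assms(14) using that assms(13) by (intro Min_le) auto
  qed
  have "path_sum t p' a m r r b = altsum K p p' a (int m) r r b"
    using assms even admissible_minimal_label[OF assms(7,8,11,12) min]
    by (intro path_sum_eq_altsum) (simp_all add: K_def)
  then have "I_sum p p' r a b m = qz (r * ((a - b) div 2)) * path_sum t p' a m r r b"
    using I_sum_eq_altsum[of m a b K p' p r] assms even by (simp add: K_def)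
  also have "\<dots> = (\<Sum>s\<in>paths p' a b m.
       qpow (energy t p' m s
             + of_nat m * (Delta t r (s ! (m - 1)) - Delta t r b
                           + (if s ! (m - 1) = b then 1 else 0))
             + Delta t r b - Delta t r a))"
    unfolding path_sum_def sum_distrib_left
  proof (rule sum.cong)
    fix s assume s: "s \<in> paths p' a b m"
    have half: "(of_int (r * ((a - b) div 2)) :: rat) = of_int (r * a) / 2 - of_int (r * b) / 2"
    proof -
      obtain c where "a - b = 2 * c"
        using even by blast
      then have "a = b + 2 * c"
        by simp
      then show ?thesis
        by (simp add: algebra_simps)
    qed
    have Delta: "Delta t r u - Delta t r v = gauge t u - gauge t v - of_int (r * u) / 2 + of_int (r * v) / 2"
      for u v
      using t_pos by (simp add: Delta_eq_gauge)
    \<comment> \<open>The linear part of \<open>Delta\<close> supplies the weights of a last step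
      down or up; a level step has weight 1 in both forms.\<close>
    have end_weight: "of_nat m * (gauge t (s ! (m - 1)) - gauge t b + of_int (end_weight r r b (s ! (m - 1))))
        = of_nat m * (Delta t r (s ! (m - 1)) - Delta t r b + (if s ! (m - 1) = b then 1 else 0))"
      using penultimate_cases[OF s] unfolding Delta
      by (auto simp: end_weight_def algebra_simps add_divide_distrib diff_divide_distrib)
    have "Delta t r b - Delta t r a = gauge t b - gauge t a + of_int (r * ((a - b) div 2))"
      unfolding Delta half by simp
    then show "qz (r * ((a - b) div 2)) * qpow (energy t p' m s
         + of_nat m * (gauge t (s ! (m - 1)) - gauge t b + of_int (end_weight r r b (s ! (m - 1))))
         + gauge t b - gauge t a) =
      qpow (energy t p' m s
             + of_nat m * (Delta t r (s ! (m - 1)) - Delta t r b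
                           + (if s ! (m - 1) = b then 1 else 0))
             + Delta t r b - Delta t r a)"
      unfolding end_weight qpow_add[symmetric] by (intro arg_cong[of _ _ qpow]) (simp add: algebra_simps)
  qed simp
  finally show ?thesis .
qed

end
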